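(* Fix $\varepsilon>0$ and let $p\to\infty$ with $k=k(p)\le p^{6/5-\varepsilon}$. Let $w_1,\dots,w_k\in\mathbb{R}^p$ be drawn independently from $\mathcal{N}(0,I_p)$. Let $v_i=\pi_i w_i$, where each $\pi_i$ is a scalar random variable such that for every $\delta>0$, $|1/\pi_i^2-1|\le p^{-1/2+\delta}$ with very high probability. (The $\pi_i$ need not be identically distributed, nor independent of the $w_i$ or of each other.) Then with very high probability there exists a symmetric matrix $Y\succeq 0$ with $v_i^\top Y v_i=1$ for all $i\in[k]$ (i.e., an ellipsoid passing through $v_1,\dots,v_k$).
   Context: "With very high probability" means with probability converging to $1$ faster than any inverse polynomial in $p$, as $p\to\infty$. *)

theory Defs
  imports "HOL-Probability.Probability"
begin

text \<open>Real p x p matrices are represented as functions nat => nat => real,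
  only the entries with indices < p being relevant; vectors in R^p as nat => real.\<close>

definition quad_form :: "nat \<Rightarrow> (nat \<Rightarrow> nat \<Rightarrow> real) \<Rightarrow> (nat \<Rightarrow> real) \<Rightarrow> real" where
  "quad_form p Y z = (\<Sum>a<p. \<Sum>b<p. z a * Y a b * z b)"

definition symmetric_psd :: "nat \<Rightarrow> (nat \<Rightarrow> nat \<Rightarrow> real) \<Rightarrow> bool" where
  "symmetric_psd p Y \<longleftrightarrow> (\<forall>a<p. \<forall>b<p. Y a b = Y b a) \<and> (\<forall>z. quad_form p Y z \<ge> 0)"

definition with_vhp :: "(nat \<Rightarrow> 'a measure) \<Rightarrow> (nat \<Rightarrow> 'a set) \<Rightarrow> bool" where
  "with_vhp M E \<longleftrightarrow> (\<forall>C::real. eventually (\<lambda>p. \<exists>A \<in> sets (M p). A \<subseteq> E p \<and>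
      measure (M p) A \<ge> 1 - real p powr (- C)) sequentially)"

end

theory Submission
  imports Defs "Jordan_Normal_Form.Determinant" "HOL-Real_Asymp.Real_Asymp"
begin

text \<open>Since $v_i = \pi_i w_i$, the requirement is $w_i^T Y w_i = 1/\pi_i^2 =: b_i$, where $b_i$ is within
  $p^{-1/2+o(1)}$ of 1 and otherwise adversarial. With $n_i = |w_i|^2$, look for
  $Y = I/p + \sum_j c_j (w_j w_j^T - (n_j/p) I)$. The traceless parts have Gram matrix
  $Z_{ij} = \langle w_i, w_j\rangle^2 - n_i n_j/p$, so the equations become $Zc = r$ with
  $r_i = b_i - n_i/p = O(p^{-1/2+o(1)})$. The diagonal of $Z$ is of order $p^2$. Its off-diagonal part $R$ is
  controlled through Gershgorin's theorem for $R^2$: conditionally on $w_i, w_j$ the entry $(R^2)_{ij}$ is a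
  sum of independent terms of mean $2 Z_{ij} = O(p^{1+o(1)})$ and size $p^2$, hence $O(p^{2.6+o(1)})$ for
  $k \le p^{6/5}$, and so $\|R\|^2 = o(p^4)$. This gives $\|c\|_2 = O(k^{1/2} p^{-5/2+o(1)})$ and then, reading
  off single rows, $\max_i |c_i| = O(k p^{-7/2+o(1)})$. As $\|\sum_j w_j w_j^T\| = O(p^{6/5+o(1)})$, the
  perturbation of $I/p$ has norm $O(p^{-1.1+o(1)}) = o(1/p)$, so $Y$ is positive definite.\<close>

section \<open>Solving a perturbed diagonal system\<close>

text \<open>Without subtracting (n_j/p) I, the off-diagonal Gram entries <w_i, w_j>^2 would have
  mean p and hence an almost rank one part of norm about kp, which swamps the diagonal p^2 once k is
  well above p. Passing to traceless parts removes exactly this. The conditional mean 2 Z_ij has a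
  simple source: E[(g^T A g)(g^T B g)] = 2 <A, B> for traceless symmetric A, B and a standard
  Gaussian vector g.

  As b may depend on all of w, cancellation in r cannot be exploited. The w-randomness is packed
  into one event about w alone, on which the system is solved for every r with small entries. Rows
  are read off singly because |c_i| <= ||c||_2 is too weak for positivity at k = p^{6/5}.

  The products Z_il Z_jl have degree four in w_l, too heavy for exponential moments, so
  concentration comes from moments of fixed but arbitrary order 2q. This is enough for polynomially
  many events. The grid behind the operator norm has exp(O(p^{6/5} log p)) points and calls for the
  Gaussian exponential tail instead.\<close>

lemma linear_system_solvable:
  fixes A :: "nat \<Rightarrow> nat \<Rightarrow> real" and r :: "nat \<Rightarrow> real"
  assumes inj: "\<And>c. \<lbrakk>\<And>i. i < k \<Longrightarrow> (\<Sum>j<k. A i j * c j) = 0\<rbrakk> \<Longrightarrow> \<forall>j<k. c j = 0"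
  obtains c where "\<And>i. i < k \<Longrightarrow> (\<Sum>j<k. A i j * c j) = r i"
proof -
  let ?A = "mat k k (\<lambda>(i, j). A i j)"
  have A: "?A \<in> carrier_mat k k" by simp
  have prod: "(?A *\<^sub>v v) $ i = (\<Sum>j<k. A i j * v $ j)" if "i < k" "v \<in> carrier_vec k" for i v
    using that by (auto simp: scalar_prod_def lessThan_atLeast0 intro!: sum.cong)
  have det: "det ?A \<noteq> 0"
  proof
    assume "det ?A = 0"
    then obtain v where v: "v \<in> carrier_vec k" "v \<noteq> 0\<^sub>v k" "?A *\<^sub>v v = 0\<^sub>v k"
      using det_0_iff_vec_prod_zero_field[OF A] by auto
    have "\<forall>j<k. v $ j = 0"
      using prod[OF _ v(1)] v(3) by (intro inj) auto
    with v(1,2) show False by auto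
  qed
  \<comment> \<open>Cramer's rule: the adjugate inverts \<open>?A\<close> up to the factor
    \<open>det ?A\<close>.\<close>
  define c where "c = (1 / det ?A) \<cdot>\<^sub>v (adj_mat ?A *\<^sub>v vec k r)"
  have adj: "adj_mat ?A \<in> carrier_mat k k" "?A * adj_mat ?A = det ?A \<cdot>\<^sub>m 1\<^sub>m k"
    using adj_mat[OF A] by auto
  have c: "c \<in> carrier_vec k" unfolding c_def using adj(1) by auto
  have "?A *\<^sub>v c = (1 / det ?A) \<cdot>\<^sub>v ((?A * adj_mat ?A) *\<^sub>v vec k r)"
    unfolding c_def using adj(1) A
    by (subst mult_mat_vec[of _ k k]) (auto simp: assoc_mult_mat_vec[of _ k k _ k])
  also have "\<dots> = vec k r"
    unfolding adj(2) using det by (intro eq_vecI) (auto simp: smult_scalar_prod_distrib[of _ k] )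
  finally have "?A *\<^sub>v c = vec k r" .
  then have "(\<Sum>j<k. A i j * c $ j) = r i" if "i < k" for i
    using prod[OF that c] that by simp
  then show ?thesis by (rule that)
qed

section \<open>Gram entries of the traceless parts, and the norm of a perturbation\<close>

text \<open>For p > 0 this is the trace inner product of a a^T - (|a|^2/p) I and u u^T - (|u|^2/p)
  I. With rows of w as arguments it is the entry Z_ij.\<close>

definition cross :: "nat \<Rightarrow> (nat \<Rightarrow> real) \<Rightarrow> (nat \<Rightarrow> real) \<Rightarrow> real" where
  "cross p a u = (\<Sum>j<p. a j * u j)\<^sup>2 - (\<Sum>j<p. (a j)\<^sup>2) * (\<Sum>j<p. (u j)\<^sup>2) / p"

lemma cross_commute: "cross p a u = cross p u a"
  by (simp add: cross_def mult.commute)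

text \<open>Turns |Rc|^2 into the quadratic form of R^T R, whose entries can be bounded one by
  one.\<close>

lemma sum_power2_swap:
  fixes R :: "nat \<Rightarrow> nat \<Rightarrow> real"
  shows "(\<Sum>i\<in>I. (\<Sum>l\<in>L. R i l * c l)\<^sup>2) = (\<Sum>l\<in>L. \<Sum>m\<in>L. c l * c m * (\<Sum>i\<in>I. R i l * R i m))"
proof -
  have "(\<Sum>i\<in>I. (\<Sum>l\<in>L. R i l * c l)\<^sup>2) = (\<Sum>i\<in>I. \<Sum>l\<in>L. \<Sum>m\<in>L. c l * c m * (R i l * R i m))"
    by (simp add: power2_eq_square sum_product mult_ac)
  also have "\<dots> = (\<Sum>l\<in>L. \<Sum>m\<in>L. \<Sum>i\<in>I. c l * c m * (R i l * R i m))"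
    by (subst sum.swap) (intro sum.cong refl sum.swap)
  finally show ?thesis by (simp add: sum_distrib_left)
qed

text \<open>Since 2 |c_l c_m| <= c_l^2 + c_m^2, the weight of each entry is shared equally between
  its row and its column. By symmetry both shares add up to the same row sums.\<close>

lemma gershgorin:
  fixes Q :: "nat \<Rightarrow> nat \<Rightarrow> real"
  assumes sym: "\<And>l m. Q l m = Q m l"
    and row: "\<And>l. l \<in> L \<Longrightarrow> (\<Sum>m\<in>L. \<bar>Q l m\<bar>) \<le> \<rho>"
  shows "(\<Sum>l\<in>L. \<Sum>m\<in>L. c l * c m * Q l m) \<le> \<rho> * (\<Sum>l\<in>L. (c l)\<^sup>2)"
proof -
  have le: "c l * c m * Q l m \<le> (c l)\<^sup>2 * \<bar>Q l m\<bar> / 2 + (c m)\<^sup>2 * \<bar>Q l m\<bar> / 2" for l m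
  proof -
    have "c l * c m * Q l m \<le> \<bar>c l\<bar> * \<bar>c m\<bar> * \<bar>Q l m\<bar>" by (metis abs_ge_self abs_mult)
    also have "\<bar>c l\<bar> * \<bar>c m\<bar> \<le> ((c l)\<^sup>2 + (c m)\<^sup>2) / 2"
      using sum_squares_bound[of "\<bar>c l\<bar>" "\<bar>c m\<bar>"] by simp
    then have "\<bar>c l\<bar> * \<bar>c m\<bar> * \<bar>Q l m\<bar> \<le> ((c l)\<^sup>2 + (c m)\<^sup>2) / 2 * \<bar>Q l m\<bar>"
      by (intro mult_right_mono) auto
    finally show ?thesis by (simp add: field_simps)
  qed
  have "(\<Sum>l\<in>L. \<Sum>m\<in>L. c l * c m * Q l m)
      \<le> (\<Sum>l\<in>L. \<Sum>m\<in>L. (c l)\<^sup>2 * \<bar>Q l m\<bar> / 2 + (c m)\<^sup>2 * \<bar>Q l m\<bar> / 2)"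
    by (intro sum_mono le)
  also have "\<dots> = (\<Sum>l\<in>L. \<Sum>m\<in>L. (c l)\<^sup>2 * \<bar>Q l m\<bar> / 2) + (\<Sum>l\<in>L. \<Sum>m\<in>L. (c m)\<^sup>2 * \<bar>Q l m\<bar> / 2)"
    by (simp add: sum.distrib)
  also have "(\<Sum>l\<in>L. \<Sum>m\<in>L. (c m)\<^sup>2 * \<bar>Q l m\<bar> / 2) = (\<Sum>l\<in>L. \<Sum>m\<in>L. (c l)\<^sup>2 * \<bar>Q l m\<bar> / 2)"
    by (subst sum.swap) (simp add: sym)
  also have "(\<Sum>l\<in>L. \<Sum>m\<in>L. (c l)\<^sup>2 * \<bar>Q l m\<bar> / 2) + (\<Sum>l\<in>L. \<Sum>m\<in>L. (c l)\<^sup>2 * \<bar>Q l m\<bar> / 2)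
      = (\<Sum>l\<in>L. (c l)\<^sup>2 * (\<Sum>m\<in>L. \<bar>Q l m\<bar>))"
    by (simp add: sum_distrib_left mult.commute flip: sum.distrib)
  also have "\<dots> \<le> (\<Sum>l\<in>L. (c l)\<^sup>2 * \<rho>)"
    by (intro sum_mono mult_left_mono row) auto
  finally show ?thesis by (simp add: sum_distrib_right mult.commute[of \<rho>])
qed

text \<open>The diagonal stretches every vector by at least 2 \<gamma> and R contributes at most
  \<gamma>, so by the triangle inequality the sum still stretches by \<gamma>. This one estimate
  yields both injectivity, hence solvability, and the norm bound.\<close>

lemma perturbed_diagonal_solution:
  fixes D :: "nat \<Rightarrow> real" and R :: "nat \<Rightarrow> nat \<Rightarrow> real"
  assumes \<gamma>: "\<gamma> > 0" and D: "\<And>i. i < k \<Longrightarrow> D i \<ge> 2 * \<gamma>"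
    and R: "\<And>c. (\<Sum>i<k. (\<Sum>j<k. R i j * c j)\<^sup>2) \<le> \<gamma>\<^sup>2 * (\<Sum>i<k. (c i)\<^sup>2)"
  obtains c where "\<And>i. i < k \<Longrightarrow> D i * c i + (\<Sum>j<k. R i j * c j) = r i"
    and "\<gamma> * L2_set c {..<k} \<le> L2_set r {..<k}"
proof -
  \<comment> \<open>Kept general in \<open>s\<close>: it is used with \<open>s = 0\<close> for
    injectivity and with \<open>s = r\<close> for the final bound.\<close>
  have lower: "\<gamma> * L2_set c {..<k} \<le> L2_set s {..<k}"
    if s: "\<And>i. i < k \<Longrightarrow> D i * c i + (\<Sum>j<k. R i j * c j) = s i" for c s
  proof -
    have "2 * \<gamma> * L2_set c {..<k} = L2_set (\<lambda>i. 2 * \<gamma> * c i) {..<k}"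
      using \<gamma> by (simp add: L2_set_right_distrib)
    also have "\<dots> \<le> L2_set (\<lambda>i. D i * c i) {..<k}"
      unfolding L2_set_def
    proof (intro real_sqrt_le_mono sum_mono)
      fix i assume "i \<in> {..<k}"
      then have "(2 * \<gamma>)\<^sup>2 \<le> (D i)\<^sup>2" using \<gamma> D by (intro power_mono) auto
      then show "(2 * \<gamma> * c i)\<^sup>2 \<le> (D i * c i)\<^sup>2"
        unfolding power_mult_distrib[of "2 * \<gamma>"] power_mult_distrib[of "D i"]
        by (intro mult_right_mono) auto
    qed
    also have "\<dots> = L2_set (\<lambda>i. s i + - (\<Sum>j<k. R i j * c j)) {..<k}"
      using s by (intro L2_set_cong) (auto simp: algebra_simps)
    also have "\<dots> \<le> L2_set s {..<k} + L2_set (\<lambda>i. - (\<Sum>j<k. R i j * c j)) {..<k}"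
      by (rule L2_set_triangle_ineq)
    also have "L2_set (\<lambda>i. - (\<Sum>j<k. R i j * c j)) {..<k} \<le> sqrt (\<gamma>\<^sup>2 * (\<Sum>i<k. (c i)\<^sup>2))"
      unfolding L2_set_def using R by (intro real_sqrt_le_mono) simp
    also have "\<dots> = \<gamma> * L2_set c {..<k}"
      using \<gamma> by (simp add: L2_set_def real_sqrt_mult)
    finally show ?thesis by simp
  qed
  let ?A = "\<lambda>i j. (if i = j then D i else 0) + R i j"
  have A: "(\<Sum>j<k. ?A i j * c j) = D i * c i + (\<Sum>j<k. R i j * c j)" if "i < k" for i c
  proof -
    have "(\<Sum>j<k. ?A i j * c j) = (\<Sum>j<k. (if j = i then D i * c i else 0) + R i j * c j)"
      by (intro sum.cong) (auto simp: algebra_simps)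
    then show ?thesis using that by (simp add: sum.distrib)
  qed
  obtain c where c0: "\<And>i. i < k \<Longrightarrow> (\<Sum>j<k. ?A i j * c j) = r i"
  proof (rule linear_system_solvable[of k ?A r])
    fix c :: "nat \<Rightarrow> real" assume 0: "\<And>i. i < k \<Longrightarrow> (\<Sum>j<k. ?A i j * c j) = 0"
    have "\<gamma> * L2_set c {..<k} \<le> L2_set (\<lambda>_. 0) {..<k}"
      using 0 A by (intro lower) simp
    then have "L2_set c {..<k} = 0"
      using \<gamma> by (simp add: L2_set_def mult_le_0_iff sum_nonneg antisym)
    then show "\<forall>j<k. c j = 0" by (simp add: L2_set_eq_0_iff)
  qed blast
  have c: "D i * c i + (\<Sum>j<k. R i j * c j) = r i" if "i < k" for i
    using A[OF that, of c] c0[OF that] by simp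
  show ?thesis by (rule that[OF c lower[OF c]])
qed

section \<open>Deterministic criterion for an ellipsoid\<close>

text \<open>Here \<open>e\<close> controls the entries of R, \<open>s\<close> the off-diagonal
  entries of R^2, \<open>\<tau>\<close> the residual r, and \<open>T\<close> the squared operator
  norm of w. The first inequality in \<open>small\<close> keeps the norm of R below half of the
  diagonal, and \<open>fin\<close> keeps the perturbation of I/p no larger than I/p itself.\<close>

lemma ellipsoid_of_weak_correlation:
  fixes w :: "nat \<Rightarrow> nat \<Rightarrow> real" and p k :: nat
    and n :: "nat \<Rightarrow> real" and e s \<tau> T :: real
  defines "n \<equiv> \<lambda>i. \<Sum>j<p. (w i j)\<^sup>2"
  assumes p: "p \<ge> 2"
    and n: "\<And>i. i < k \<Longrightarrow> p / 2 \<le> n i \<and> n i \<le> 2 * p"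
    and off: "\<And>i j. \<lbrakk>i < k; j < k; i \<noteq> j\<rbrakk> \<Longrightarrow> \<bar>cross p (w i) (w j)\<bar> \<le> e"
    and off2: "\<And>i j. \<lbrakk>i < k; j < k; i \<noteq> j\<rbrakk> \<Longrightarrow>
      \<bar>\<Sum>l\<in>{..<k} - {i, j}. cross p (w i) (w l) * cross p (w j) (w l)\<bar> \<le> s"
    and small: "k * e\<^sup>2 + k * s \<le> (p\<^sup>2 / 16)\<^sup>2" "e \<ge> 0" "s \<ge> 0" "\<tau> \<ge> 0" "T \<ge> 0"
    and op: "\<And>x. (\<Sum>i<k. (\<Sum>j<p. w i j * x j)\<^sup>2) \<le> T * (\<Sum>j<p. (x j)\<^sup>2)"
    and b: "\<And>i. i < k \<Longrightarrow> \<bar>b i - n i / p\<bar> \<le> \<tau>"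
    and fin: "8 / p\<^sup>2 * (\<tau> + 16 * k * e * \<tau> / p\<^sup>2) * (2 * k + T) \<le> 1 / p"
  shows "\<exists>Y. symmetric_psd p Y \<and> (\<forall>i<k. quad_form p Y (w i) = b i)"
proof -
  define O' where "O' i j = (if i = j then 0 else cross p (w i) (w j))" for i j
  have O'_sym: "O' i j = O' j i" for i j by (simp add: O'_def cross_commute)
  have O'_le: "\<bar>O' i j\<bar> \<le> e" if "i < k" "j < k" for i j
    using off that small(2) by (auto simp: O'_def)
  have P_diag: "\<bar>\<Sum>i<k. O' i l * O' i l\<bar> \<le> k * e\<^sup>2" if "l < k" for l
  proof -
    have "\<bar>\<Sum>i<k. O' i l * O' i l\<bar> \<le> (\<Sum>i<k. \<bar>O' i l * O' i l\<bar>)" by (rule sum_abs)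
    also have "\<dots> \<le> (\<Sum>i<k. e\<^sup>2)"
      using O'_le[OF _ that] small(2)
      unfolding abs_mult power2_eq_square by (intro sum_mono mult_mono) auto
    finally show ?thesis by simp
  qed
  have P_off: "\<bar>\<Sum>i<k. O' i l * O' i m\<bar> \<le> s" if "l < k" "m < k" "l \<noteq> m" for l m
  proof -
    \<comment> \<open>The zero diagonal of \<open>O'\<close> drops the indices \<open>l\<close> and
      \<open>m\<close>, leaving just the rows that are independent of rows \<open>l\<close> and
      \<open>m\<close> in the application.\<close>
    have "(\<Sum>i<k. O' i l * O' i m) = (\<Sum>i\<in>{..<k} - {l, m}. O' i l * O' i m)"
      by (intro sum.mono_neutral_right) (auto simp: O'_def)
    also have "\<dots> = (\<Sum>i\<in>{..<k} - {l, m}. cross p (w l) (w i) * cross p (w m) (w i))"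
      by (intro sum.cong) (auto simp: O'_def cross_commute)
    finally show ?thesis using off2[OF that] by simp
  qed
  have O'_norm: "(\<Sum>i<k. (\<Sum>j<k. O' i j * c j)\<^sup>2) \<le> (p\<^sup>2 / 16)\<^sup>2 * (\<Sum>i<k. (c i)\<^sup>2)" for c
  proof -
    have "(\<Sum>i<k. (\<Sum>j<k. O' i j * c j)\<^sup>2) \<le> (k * e\<^sup>2 + k * s) * (\<Sum>i<k. (c i)\<^sup>2)"
      unfolding sum_power2_swap
    proof (rule gershgorin)
      fix l assume "l \<in> {..<k}"
      then have l: "l < k" by simp
      \<comment> \<open>Adding \<open>s\<close> on the diagonal as well is harmless and makes the
        row sum uniform.\<close>
      have "(\<Sum>m<k. \<bar>\<Sum>i<k. O' i l * O' i m\<bar>) \<le> (\<Sum>m<k. (if m = l then k * e\<^sup>2 else 0) + s)"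
        using P_diag P_off l small(3) by (intro sum_mono) force
      also have "\<dots> = k * e\<^sup>2 + k * s" using l by (simp add: sum.distrib)
      finally show "(\<Sum>m<k. \<bar>\<Sum>i<k. O' i l * O' i m\<bar>) \<le> k * e\<^sup>2 + k * s" .
    qed (auto simp: mult.commute)
    also have "\<dots> \<le> (p\<^sup>2 / 16)\<^sup>2 * (\<Sum>i<k. (c i)\<^sup>2)"
      using small(1) by (intro mult_right_mono) (auto intro: sum_nonneg)
    finally show ?thesis .
  qed
  define D where "D i = (n i)\<^sup>2 * (1 - 1 / p)" for i
  have D_eq: "cross p (w i) (w i) = D i" for i
    using p by (simp add: D_def cross_def n_def power2_eq_square field_simps)
  \<comment> \<open>The factor 1 - 1/p is at least 1/2 because \<open>p \<ge> 2\<close>. The result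
    is twice the norm \<open>p\<^sup>2 / 16\<close> granted to the off-diagonal part.\<close>
  have D_ge: "D i \<ge> p\<^sup>2 / 8" if "i < k" for i
  proof -
    have "(p / 2)\<^sup>2 * (1 / 2) \<le> (n i)\<^sup>2 * (1 - 1 / p)"
      using n[OF that] p by (intro mult_mono power_mono) (auto simp: field_simps)
    then show ?thesis by (simp add: D_def power2_eq_square)
  qed
  define r where "r i = b i - n i / p" for i
  obtain c where c: "\<And>i. i < k \<Longrightarrow> D i * c i + (\<Sum>j<k. O' i j * c j) = r i"
    and c_norm: "p\<^sup>2 / 16 * L2_set c {..<k} \<le> L2_set r {..<k}"
  proof (rule perturbed_diagonal_solution[of "p\<^sup>2 / 16" k D O' r])
    show "2 * (p\<^sup>2 / 16) \<le> D i" if "i < k" for i using D_ge[OF that] by simp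
  qed (use p O'_norm in auto)
  have r_norm: "L2_set r {..<k} \<le> sqrt k * \<tau>"
  proof -
    have "L2_set r {..<k} \<le> sqrt (\<Sum>i<k. \<tau>\<^sup>2)"
      unfolding L2_set_def using b r_def
      by (intro real_sqrt_le_mono sum_mono) (metis abs_ge_zero lessThan_iff power2_abs power_mono)
    then show ?thesis using small by (simp add: real_sqrt_mult)
  qed
  have c_norm': "L2_set c {..<k} \<le> 16 / p\<^sup>2 * sqrt k * \<tau>"
    using order_trans[OF c_norm r_norm] p by (simp add: field_simps)
  \<comment> \<open>The bound for max |c_i|. The factor \<open>8 / p\<^sup>2\<close> inverts
    \<open>D i\<close>, \<open>\<tau>\<close> accounts for \<open>r i\<close>, and the last term is
    Cauchy-Schwarz for a row of R (norm at most sqrt k e) against c (norm at most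
    \<open>16 / p\<^sup>2 * sqrt k * \<tau>\<close>).\<close>
  define \<beta> where "\<beta> = 8 / p\<^sup>2 * (\<tau> + 16 * k * e * \<tau> / p\<^sup>2)"
  have \<beta>0: "\<beta> \<ge> 0" unfolding \<beta>_def using small by simp
  have c_max: "\<bar>c i\<bar> \<le> \<beta>" if i: "i < k" for i
  proof -
    have "\<bar>\<Sum>j<k. O' i j * c j\<bar> \<le> L2_set (O' i) {..<k} * L2_set c {..<k}"
      by (rule order_trans[OF sum_abs]) (simp only: abs_mult L2_set_mult_ineq)
    also have "L2_set (O' i) {..<k} \<le> sqrt (\<Sum>j<k. e\<^sup>2)"
      unfolding L2_set_def using O'_le[OF i]
      by (intro real_sqrt_le_mono sum_mono) (metis abs_ge_zero lessThan_iff power2_abs power_mono)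
    also have "\<dots> = sqrt k * e" using small by (simp add: real_sqrt_mult)
    finally have "\<bar>\<Sum>j<k. O' i j * c j\<bar> \<le> sqrt k * e * L2_set c {..<k}"
      by (simp add: mult_right_mono)
    also have "\<dots> \<le> sqrt k * e * (16 / p\<^sup>2 * sqrt k * \<tau>)"
      using c_norm' small by (intro mult_left_mono) auto
    also have "\<dots> = 16 * k * e * \<tau> / p\<^sup>2"
      by (simp add: field_simps flip: power2_eq_square)
    finally have "\<bar>D i * c i\<bar> \<le> \<tau> + 16 * k * e * \<tau> / p\<^sup>2"
      using c[OF i] b[OF i] unfolding r_def by linarith
    moreover have "p\<^sup>2 / 8 * \<bar>c i\<bar> \<le> \<bar>D i * c i\<bar>"
      unfolding abs_mult using D_ge[OF i] by (intro mult_right_mono) auto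
    ultimately have "p\<^sup>2 / 8 * \<bar>c i\<bar> \<le> \<tau> + 16 * k * e * \<tau> / p\<^sup>2" by linarith
    then have "8 / p\<^sup>2 * (p\<^sup>2 / 8 * \<bar>c i\<bar>) \<le> \<beta>"
      unfolding \<beta>_def by (intro mult_left_mono) auto
    then show ?thesis using p by simp
  qed
  \<comment> \<open>Collects all multiples of I in Y: the leading I/p and the trace corrections
    -(c_i n_i / p) I.\<close>
  define t where "t = 1 / p - (\<Sum>i<k. c i * n i) / p"
  define Y where "Y a d = (if a = d then t else 0) + (\<Sum>i<k. c i * w i a * w i d)" for a d
  have Y_form: "quad_form p Y z = t * (\<Sum>j<p. (z j)\<^sup>2) + (\<Sum>i<k. c i * (\<Sum>j<p. w i j * z j)\<^sup>2)" for z
  proof -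
    have 1: "(\<Sum>d<p. z a * (if a = d then t else 0) * z d) = t * (z a)\<^sup>2" if "a < p" for a
    proof -
      have "(\<Sum>d<p. z a * (if a = d then t else 0) * z d) = (\<Sum>d<p. if d = a then t * (z a)\<^sup>2 else 0)"
        by (intro sum.cong) (auto simp: power2_eq_square)
      then show ?thesis using that by simp
    qed
    have "quad_form p Y z = (\<Sum>a<p. \<Sum>d<p. z a * (if a = d then t else 0) * z d)
        + (\<Sum>a<p. \<Sum>d<p. \<Sum>i<k. c i * ((w i a * z a) * (w i d * z d)))"
      by (simp add: quad_form_def Y_def algebra_simps sum.distrib sum_distrib_left)
    also have "(\<Sum>a<p. \<Sum>d<p. z a * (if a = d then t else 0) * z d) = t * (\<Sum>j<p. (z j)\<^sup>2)"
      by (simp add: 1 sum_distrib_left)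
    also have "(\<Sum>a<p. \<Sum>d<p. \<Sum>i<k. c i * ((w i a * z a) * (w i d * z d)))
        = (\<Sum>a<p. \<Sum>i<k. \<Sum>d<p. c i * ((w i a * z a) * (w i d * z d)))"
      by (intro sum.cong refl sum.swap)
    also have "\<dots> = (\<Sum>i<k. \<Sum>a<p. \<Sum>d<p. c i * ((w i a * z a) * (w i d * z d)))"
      by (rule sum.swap)
    also have "\<dots> = (\<Sum>i<k. c i * (\<Sum>j<p. w i j * z j)\<^sup>2)"
      unfolding power2_eq_square sum_product by (simp only: sum_distrib_left)
    finally show ?thesis .
  qed
  have "symmetric_psd p Y"
    unfolding symmetric_psd_def
  proof (intro conjI allI impI)
    fix z
    have "\<bar>\<Sum>i<k. c i * n i\<bar> \<le> (\<Sum>i<k. \<bar>c i * n i\<bar>)" by (rule sum_abs)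
    also have "\<dots> \<le> (\<Sum>i<k. \<beta> * (2 * p))"
      using n c_max \<beta>0 unfolding abs_mult by (intro sum_mono mult_mono) force+
    finally have "\<bar>\<Sum>i<k. c i * n i\<bar> / p \<le> 2 * k * \<beta>" using p by (simp add: field_simps)
    then have t: "t \<ge> 1 / p - 2 * k * \<beta>"
      unfolding t_def using p by (smt (verit) divide_right_mono of_nat_0_le_iff)
    have "\<bar>\<Sum>i<k. c i * (\<Sum>j<p. w i j * z j)\<^sup>2\<bar> \<le> (\<Sum>i<k. \<bar>c i\<bar> * (\<Sum>j<p. w i j * z j)\<^sup>2)"
      by (rule order_trans[OF sum_abs]) (simp add: abs_mult)
    also have "\<dots> \<le> (\<Sum>i<k. \<beta> * (\<Sum>j<p. w i j * z j)\<^sup>2)"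
      using c_max by (intro sum_mono mult_right_mono) auto
    also have "\<dots> \<le> \<beta> * (T * (\<Sum>j<p. (z j)\<^sup>2))"
      unfolding sum_distrib_left[symmetric] using op \<beta>0 by (intro mult_left_mono)
    finally have "\<bar>\<Sum>i<k. c i * (\<Sum>j<p. w i j * z j)\<^sup>2\<bar> \<le> \<beta> * T * (\<Sum>j<p. (z j)\<^sup>2)" by (simp add: mult_ac)
    moreover have "t * (\<Sum>j<p. (z j)\<^sup>2) \<ge> (1 / p - 2 * k * \<beta>) * (\<Sum>j<p. (z j)\<^sup>2)"
      using t by (intro mult_right_mono sum_nonneg) auto
    \<comment> \<open>This is \<open>fin\<close>: the part 2k\<beta> pays for the trace corrections,
      \<beta>T for the rank one terms.\<close>
    moreover have "(1 / p - 2 * k * \<beta> - \<beta> * T) * (\<Sum>j<p. (z j)\<^sup>2) \<ge> 0"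
      using fin unfolding \<beta>_def[symmetric]
      by (intro mult_nonneg_nonneg sum_nonneg) (auto simp: algebra_simps)
    ultimately show "quad_form p Y z \<ge> 0"
      unfolding Y_form by (simp add: algebra_simps)
  qed (auto simp: Y_def mult_ac)
  moreover have "quad_form p Y (w i) = b i" if i: "i < k" for i
  proof -
    have cross_n: "cross p (w l) (w i) = (\<Sum>j<p. w l j * w i j)\<^sup>2 - n l * n i / p" for l
      by (simp add: cross_def n_def)
    \<comment> \<open>By the choice of \<open>t\<close>, the value of the form at \<open>w i\<close>
      is \<open>n i / p\<close> plus the i-th entry of Zc. The latter is \<open>r i\<close>, so the
      total is \<open>b i\<close>.\<close>
    have "(\<Sum>l<k. c l * (\<Sum>j<p. w l j * w i j)\<^sup>2) - n i * (\<Sum>l<k. c l * n l) / p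
        = (\<Sum>l<k. c l * cross p (w l) (w i))"
      by (simp add: cross_n right_diff_distrib sum_subtractf sum_distrib_left
          sum_divide_distrib mult_ac)
    also have "\<dots> = (\<Sum>l<k. (if l = i then D i * c i else 0) + O' i l * c l)"
      using D_eq by (intro sum.cong) (auto simp: O'_def cross_commute)
    also have "\<dots> = r i" using c[OF i] i by (simp add: sum.distrib)
    finally have "(\<Sum>l<k. c l * (\<Sum>j<p. w l j * w i j)\<^sup>2) - n i * (\<Sum>l<k. c l * n l) / p = r i" .
    moreover have "(\<Sum>j<p. (w i j)\<^sup>2) = n i" by (simp add: n_def)
    ultimately show ?thesis
      unfolding Y_form t_def r_def by (simp add: algebra_simps)
  qed
  ultimately show ?thesis by blast
qed

section \<open>Moments of sums of independent variables\<close>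

text \<open>Having all power moments is preserved by sums and products, so integrability of every
  polynomial in Gaussian variables follows by closure rules instead of separate estimates.\<close>

definition has_moments :: "'a measure \<Rightarrow> ('a \<Rightarrow> real) \<Rightarrow> bool" where
  "has_moments M X \<longleftrightarrow> X \<in> borel_measurable M \<and> (\<forall>m. integrable M (\<lambda>x. X x ^ m))"

lemma has_momentsD:
  assumes "has_moments M X"
  shows "X \<in> borel_measurable M" "integrable M (\<lambda>x. X x ^ m)" "integrable M X"
  using assms spec[of "\<lambda>m. integrable M (\<lambda>x. X x ^ m)" 1] by (auto simp: has_moments_def)

lemma has_moments_uminus: "has_moments M X \<Longrightarrow> has_moments M (\<lambda>x. - X x)"
  unfolding has_moments_def by (subst power_minus) auto

lemma has_moments_power: "has_moments M X \<Longrightarrow> has_moments M (\<lambda>x. X x ^ n)"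
  by (auto simp: has_moments_def simp flip: power_mult)

lemma has_moments_cmult: "has_moments M X \<Longrightarrow> has_moments M (\<lambda>x. a * X x)"
  by (auto simp: has_moments_def power_mult_distrib)

lemma has_moments_divide: "has_moments M X \<Longrightarrow> has_moments M (\<lambda>x. X x / a)"
  using has_moments_cmult[of M X "1 / a"] by simp

lemma has_moments_add:
  assumes "has_moments M X" "has_moments M Y"
  shows "has_moments M (\<lambda>x. X x + Y x)"
  unfolding has_moments_def
proof (intro conjI allI)
  note [measurable] = has_momentsD(1)[OF assms(1)] has_momentsD(1)[OF assms(2)]
  show "(\<lambda>x. X x + Y x) \<in> borel_measurable M" by measurable
  fix m
  show "integrable M (\<lambda>x. (X x + Y x) ^ m)"
  proof (rule Bochner_Integration.integrable_bound)
    show "integrable M (\<lambda>x. 2 ^ m * (\<bar>X x ^ m\<bar> + \<bar>Y x ^ m\<bar>))"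
      using assms by (intro integrable_mult_right Bochner_Integration.integrable_add integrable_abs has_momentsD(2))
    have "\<bar>a + b\<bar> ^ m \<le> 2 ^ m * (\<bar>a\<bar> ^ m + \<bar>b\<bar> ^ m)" for a b :: real
    proof -
      have "\<bar>a + b\<bar> ^ m \<le> (2 * max \<bar>a\<bar> \<bar>b\<bar>) ^ m" by (intro power_mono) auto
      also have "\<dots> \<le> 2 ^ m * (\<bar>a\<bar> ^ m + \<bar>b\<bar> ^ m)"
        by (auto simp: power_mult_distrib max_def)
      finally show ?thesis .
    qed
    then show "AE x in M. norm ((X x + Y x) ^ m) \<le> norm (2 ^ m * (\<bar>X x ^ m\<bar> + \<bar>Y x ^ m\<bar>))"
      by (auto simp: power_abs)
  qed measurable
qed

lemma has_moments_diff:
  "has_moments M X \<Longrightarrow> has_moments M Y \<Longrightarrow> has_moments M (\<lambda>x. X x - Y x)"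
  using has_moments_add[OF _ has_moments_uminus, of M X Y] by simp

text \<open>The bound |ab| <= a^2 + b^2 trades a product for doubled exponents, which are available
  because all moments are assumed at once.\<close>

lemma has_moments_mult:
  assumes "has_moments M X" "has_moments M Y"
  shows "has_moments M (\<lambda>x. X x * Y x)"
  unfolding has_moments_def
proof (intro conjI allI)
  note [measurable] = has_momentsD(1)[OF assms(1)] has_momentsD(1)[OF assms(2)]
  show "(\<lambda>x. X x * Y x) \<in> borel_measurable M" by measurable
  fix m
  show "integrable M (\<lambda>x. (X x * Y x) ^ m)"
  proof (rule Bochner_Integration.integrable_bound)
    show "integrable M (\<lambda>x. X x ^ (2 * m) + Y x ^ (2 * m))"
      using assms by (intro Bochner_Integration.integrable_add has_momentsD(2))
    have "\<bar>a * b\<bar> \<le> a\<^sup>2 + b\<^sup>2" for a b :: real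
    proof -
      have "0 \<le> \<bar>a\<bar> * \<bar>b\<bar>" "2 * \<bar>a\<bar> * \<bar>b\<bar> \<le> \<bar>a\<bar>\<^sup>2 + \<bar>b\<bar>\<^sup>2"
        by (simp, rule sum_squares_bound)
      then show ?thesis unfolding abs_mult power2_abs by linarith
    qed
    then have "\<bar>X x ^ m * Y x ^ m\<bar> \<le> X x ^ (2 * m) + Y x ^ (2 * m)" for x
      by (metis power_mult mult.commute)
    then show "AE x in M. norm ((X x * Y x) ^ m) \<le> norm (X x ^ (2 * m) + Y x ^ (2 * m))"
      unfolding power_mult_distrib real_norm_def by (intro AE_I2 order_trans[OF _ abs_ge_self])
  qed measurable
qed

context prob_space
begin

lemma has_moments_const: "has_moments M (\<lambda>_. c)"
  by (auto simp: has_moments_def)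

lemma has_moments_sum:
  "(\<And>i. i \<in> I \<Longrightarrow> has_moments M (X i)) \<Longrightarrow> has_moments M (\<lambda>x. \<Sum>i\<in>I. X i x)"
  by (induction I rule: infinite_finite_induct) (auto intro: has_moments_add has_moments_const)

lemmas has_moments_intros = has_moments_const has_moments_add has_moments_diff has_moments_mult
  has_moments_power has_moments_divide has_moments_sum

text \<open>Markov's inequality for X^{2q}; the even exponent removes the absolute value, so the
  moment stays polynomial.\<close>

lemma even_moment_Markov:
  assumes X: "has_moments M X" and t: "t > 0"
  shows "prob {x \<in> space M. \<bar>X x\<bar> > t} \<le> expectation (\<lambda>x. X x ^ (2 * q)) / t ^ (2 * q)"
proof -
  note [measurable] = has_momentsD(1)[OF X]
  have "prob {x \<in> space M. \<bar>X x\<bar> > t} \<le> prob {x \<in> space M. X x ^ (2 * q) \<ge> t ^ (2 * q)}"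
  proof (rule finite_measure_mono)
    have "t ^ (2 * q) \<le> X x ^ (2 * q)" if "\<bar>X x\<bar> > t" for x
      using that t power_mono[of t "\<bar>X x\<bar>" "2 * q"] by (simp add: power_even_abs)
    then show "{x \<in> space M. \<bar>X x\<bar> > t} \<subseteq> {x \<in> space M. X x ^ (2 * q) \<ge> t ^ (2 * q)}"
      by auto
  qed measurable
  also have "\<dots> \<le> expectation (\<lambda>x. X x ^ (2 * q)) / t ^ (2 * q)"
    using integral_Markov_inequality_measure[of M "\<lambda>x. X x ^ (2 * q)" "{}" "t ^ (2 * q)"] X t
    by (auto intro: has_momentsD simp: zero_le_even_power)
  finally show ?thesis .
qed

end

section \<open>Moment inequality for centered independent sums\<close>

text \<open>In the binomial expansion the linear term in x is kept exact, since its expectation will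
  vanish. Every later term is x^2 times a monomial of degree 2q in x and s, hence at most x^2
  (x^{2q} + s^{2q}), and the binomial coefficients sum to at most 2^{2q+2} = 4^{q+1}.\<close>

lemma power_add_le_second_order:
  fixes s x :: real
  shows "(s + x) ^ (2 * q + 2) \<le> s ^ (2 * q + 2) + real (2 * q + 2) * (s ^ (2 * q + 1) * x)
    + 4 ^ (q + 1) * (s ^ (2 * q) * x ^ 2 + x ^ (2 * q + 2))"
proof -
  let ?N = "Suc (Suc (2 * q))"
  let ?B = "s ^ (2 * q) * x ^ 2 + x ^ (2 * q + 2)"
  have B0: "?B \<ge> 0"
    by (intro add_nonneg_nonneg mult_nonneg_nonneg)
      (simp_all only: zero_le_even_power even_mult_iff even_add even_numeral simp_thms)
  have summand: "x ^ (i + 2) * s ^ (2 * q - i) \<le> ?B" if "i \<le> 2 * q" for i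
  proof -
    define m where "m = max \<bar>x\<bar> \<bar>s\<bar>"
    have "x ^ i * s ^ (2 * q - i) \<le> \<bar>x\<bar> ^ i * \<bar>s\<bar> ^ (2 * q - i)"
      by (metis abs_ge_self abs_mult power_abs)
    also have "\<dots> \<le> m ^ i * m ^ (2 * q - i)"
      unfolding m_def by (intro mult_mono power_mono) auto
    also have "\<dots> = m ^ (2 * q)" using that by (simp flip: power_add)
    also have "\<dots> \<le> x ^ (2 * q) + s ^ (2 * q)"
      by (auto simp: m_def max_def power_even_abs zero_le_even_power)
    finally have le: "x\<^sup>2 * (x ^ i * s ^ (2 * q - i)) \<le> x\<^sup>2 * (x ^ (2 * q) + s ^ (2 * q))"
      by (intro mult_left_mono) auto
    have e: "x ^ (j + 2) = x\<^sup>2 * x ^ j" for j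
      by (simp only: power_add mult.commute)
    show ?thesis unfolding e using le by (simp only: distrib_left mult_ac add_ac)
  qed
  have "(\<Sum>i\<le>2 * q. real (?N choose (i + 2)) * (x ^ (i + 2) * s ^ (2 * q - i)))
      \<le> (\<Sum>i\<le>2 * q. real (?N choose (i + 2)) * ?B)"
    by (intro sum_mono mult_left_mono summand) simp_all
  also have "\<dots> = (\<Sum>i\<le>2 * q. real (?N choose (i + 2))) * ?B"
    by (rule sum_distrib_right[symmetric])
  also have "\<dots> \<le> 4 ^ (q + 1) * ?B"
  proof (rule mult_right_mono[OF _ B0])
    have "(\<Sum>i\<le>2 * q. ?N choose (i + 2)) \<le> (\<Sum>i\<le>?N. ?N choose i)"
      unfolding sum.atMost_Suc_shift by (simp del: binomial_Suc_Suc)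
    also have "\<dots> = 4 ^ (q + 1)"
      by (subst choose_row_sum) (simp add: power_mult)
    finally have "real (\<Sum>i\<le>2 * q. ?N choose (i + 2)) \<le> real (4 ^ (q + 1))"
      by (rule of_nat_mono)
    then show "(\<Sum>i\<le>2 * q. real (?N choose (i + 2))) \<le> 4 ^ (q + 1)"
      unfolding of_nat_sum of_nat_power of_nat_numeral .
  qed
  finally have tail: "(\<Sum>i\<le>2 * q. real (?N choose (i + 2)) * (x ^ (i + 2) * s ^ (2 * q - i))) \<le> 4 ^ (q + 1) * ?B" .
  have "(s + x) ^ ?N = (\<Sum>i\<le>?N. real (?N choose i) * x ^ i * s ^ (?N - i))"
    by (subst add.commute) (rule binomial_ring)
  also have "\<dots> = s ^ ?N + ?N * x * s ^ Suc (2 * q)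
      + (\<Sum>i\<le>2 * q. real (?N choose (i + 2)) * (x ^ (i + 2) * s ^ (2 * q - i)))"
    unfolding sum.atMost_Suc_shift by (simp add: mult.assoc del: binomial_Suc_Suc)
  also have "\<dots> \<le> s ^ ?N + ?N * x * s ^ Suc (2 * q) + 4 ^ (q + 1) * ?B"
    using tail by (rule add_left_mono)
  finally show ?thesis
    unfolding add_2_eq_Suc' Suc_eq_plus1[symmetric] by (simp only: mult_ac)
qed

text \<open>The recursion mirrors \<open>power_add_le_second_order\<close>: the first summand serves
  s^{2q} x^2, a lower moment of the sum times a second moment of the new variable, and the second
  serves x^{2q+2}.\<close>

fun moment_const :: "(nat \<Rightarrow> real) \<Rightarrow> nat \<Rightarrow> real" where
  "moment_const C 0 = 1"
| "moment_const C (Suc q) = 4 ^ Suc q * (moment_const C q * C 1 + C (Suc q))"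

lemma moment_const_nonneg: "(\<And>m. C m \<ge> 0) \<Longrightarrow> moment_const C q \<ge> 0"
  by (induction q) auto

text \<open>A Rosenthal-type bound: up to a factor depending on q alone, the sum behaves like a
  Gaussian of variance \<Sum> \<beta>_i, whatever the number of summands. Variables are added one at
  a time; independence and mean zero kill the linear term, and the second order terms fit into the
  growth of (\<Sum> \<beta>_i)^q.\<close>

lemma (in prob_space) sum_even_moment:
  fixes X :: "'i \<Rightarrow> 'a \<Rightarrow> real"
  assumes fin: "finite I" and indep: "indep_vars (\<lambda>_. borel) X I"
    and mom: "\<And>i. i \<in> I \<Longrightarrow> has_moments M (X i)"
    and mean: "\<And>i. i \<in> I \<Longrightarrow> expectation (X i) = 0"
    and bound: "\<And>i m. i \<in> I \<Longrightarrow> expectation (\<lambda>x. X i x ^ (2 * m)) \<le> C m * \<beta> i ^ m"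
    and nonneg: "\<And>i. i \<in> I \<Longrightarrow> \<beta> i \<ge> 0" "\<And>m. C m \<ge> 0"
  shows "expectation (\<lambda>x. (\<Sum>i\<in>I. X i x) ^ (2 * q)) \<le> moment_const C q * (\<Sum>i\<in>I. \<beta> i) ^ q"
  using fin indep mom mean bound nonneg(1)
proof (induction I arbitrary: q rule: finite_induct)
  case empty
  then show ?case by (cases q) (auto simp: prob_space)
next
  case (insert i I)
  let ?S = "\<lambda>x. \<Sum>i\<in>I. X i x" and ?s = "\<Sum>i\<in>I. \<beta> i"
  have IH: "expectation (\<lambda>x. ?S x ^ (2 * q)) \<le> moment_const C q * ?s ^ q" for q
    using insert.prems by (intro insert.IH indep_vars_subset[OF insert.prems(1)]) auto
  have s: "?s \<ge> 0" using insert.prems(5) by (intro sum_nonneg) auto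
  have b: "\<beta> i \<ge> 0" using insert.prems(5) by auto
  have S: "has_moments M ?S" using insert.prems(2) by (intro has_moments_sum) auto
  have Xi: "has_moments M (X i)" using insert.prems(2) by auto
  have ind: "indep_var borel (X i) borel ?S"
    using insert by (intro indep_vars_sum) auto
  have ind_pow: "expectation (\<lambda>x. ?S x ^ a * X i x ^ c) = expectation (\<lambda>x. ?S x ^ a) * expectation (\<lambda>x. X i x ^ c)" for a c
  proof -
    have "indep_var borel ((\<lambda>y. y ^ c) \<circ> X i) borel ((\<lambda>y. y ^ a) \<circ> ?S)"
      by (intro indep_var_compose[OF ind]) measurable
    then have "expectation (\<lambda>x. X i x ^ c * ?S x ^ a) = expectation (\<lambda>x. X i x ^ c) * expectation (\<lambda>x. ?S x ^ a)"
      by (intro indep_var_lebesgue_integral has_momentsD S Xi) (simp add: comp_def)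
    then show ?thesis by (simp add: mult.commute)
  qed
  show ?case
  proof (cases q)
    case 0
    then show ?thesis by (simp add: prob_space)
  next
    case (Suc r)
    let ?A = "moment_const C"
    have int: "integrable M (\<lambda>x. ?S x ^ a * X i x ^ c)" for a c
      using has_momentsD(3) has_moments_mult has_moments_power S Xi by blast
    have int1: "integrable M (\<lambda>x. ?S x ^ a * X i x)" for a
      using int[of a 1] by simp
    have "expectation (\<lambda>x. (?S x + X i x) ^ (2 * r + 2)) \<le> expectation (\<lambda>x. ?S x ^ (2 * r + 2)
      + real (2 * r + 2) * (?S x ^ (2 * r + 1) * X i x) + 4 ^ (r + 1) * (?S x ^ (2 * r) * X i x ^ 2 + X i x ^ (2 * r + 2)))"
      by (intro integral_mono power_add_le_second_order has_momentsD(2) has_moments_add S Xi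
          Bochner_Integration.integrable_add integrable_mult_right int int1)
    also have "\<dots> = expectation (\<lambda>x. ?S x ^ (2 * r + 2)) + real (2 * r + 2) * expectation (\<lambda>x. ?S x ^ (2 * r + 1) * X i x)
       + 4 ^ (r + 1) * (expectation (\<lambda>x. ?S x ^ (2 * r) * X i x ^ 2) + expectation (\<lambda>x. X i x ^ (2 * r + 2)))"
      by (simp add: int int1 has_momentsD(2) S Xi del: power_Suc One_nat_def)
    finally have expand: "expectation (\<lambda>x. (?S x + X i x) ^ (2 * r + 2)) \<le> \<dots>" .
    have e1: "expectation (\<lambda>x. ?S x ^ (2 * r + 1) * X i x) = 0"
      using ind_pow[of "2 * r + 1" 1] insert.prems(3) by simp
    have e2: "expectation (\<lambda>x. ?S x ^ (2 * r) * X i x ^ 2) \<le> (?A r * ?s ^ r) * (C 1 * \<beta> i)"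
      unfolding ind_pow using IH[of r] insert.prems(4)[of i 1] s b
      by (intro mult_mono) (auto intro!: integral_nonneg mult_nonneg_nonneg moment_const_nonneg nonneg(2))
    have e3: "expectation (\<lambda>x. X i x ^ (2 * r + 2)) \<le> C (r + 1) * \<beta> i ^ (r + 1)"
      using insert.prems(4)[of i "r + 1"] by simp
    have e4: "expectation (\<lambda>x. ?S x ^ (2 * r + 2)) \<le> ?A (r + 1) * ?s ^ (r + 1)"
      using IH[of "r + 1"] by simp
    have "expectation (\<lambda>x. (?S x + X i x) ^ (2 * r + 2)) \<le> ?A (r + 1) * ?s ^ (r + 1) + real (2 * r + 2) * 0
      + 4 ^ (r + 1) * ((?A r * ?s ^ r) * (C 1 * \<beta> i) + C (r + 1) * \<beta> i ^ (r + 1))"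
      by (rule order_trans[OF expand[unfolded e1]]) (intro add_mono mult_left_mono e2 e3 e4 order_refl, simp)
    also have "\<dots> = ?A (r + 1) * ?s ^ (r + 1)
      + 4 ^ (r + 1) * (?A r * C 1 * (\<beta> i * ?s ^ r) + C (r + 1) * (\<beta> i * \<beta> i ^ r))"
      by (simp add: mult_ac)
    also have "\<dots> \<le> ?A (r + 1) * ?s ^ (r + 1)
      + 4 ^ (r + 1) * (?A r * C 1 * (\<beta> i * (?s + \<beta> i) ^ r) + C (r + 1) * (\<beta> i * (?s + \<beta> i) ^ r))"
      using s b by (intro add_left_mono mult_left_mono add_mono power_mono) (auto simp: nonneg(2) moment_const_nonneg)
    \<comment> \<open>The recursion for \<open>moment_const\<close> makes the coefficient of the
      increment equal to that of the old bound. The increment then completes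
      \<open>(?s + \<beta> i) ^ (r + 1)\<close>, so the constant does not grow with the
      insertions.\<close>
    also have "\<dots> = ?A (r + 1) * (?s * ?s ^ r + \<beta> i * (?s + \<beta> i) ^ r)"
      by (simp add: algebra_simps)
    also have "\<dots> \<le> ?A (r + 1) * (?s * (?s + \<beta> i) ^ r + \<beta> i * (?s + \<beta> i) ^ r)"
      using s b by (intro add_right_mono mult_left_mono power_mono moment_const_nonneg nonneg(2)) auto
    also have "\<dots> = ?A (r + 1) * (?s + \<beta> i) ^ (r + 1)" by (simp add: algebra_simps)
    finally show ?thesis
      using insert.hyps Suc by (simp add: add.commute)
  qed
qed

section \<open>Gaussian linear and quadratic forms\<close>

text \<open>The double factorial (2m-1)!!, which is the 2m-th moment of N(0, 1).\<close>

definition gauss_moment :: "nat \<Rightarrow> real" where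
  "gauss_moment m = fact (2 * m) / (2 ^ m * fact m)"

definition gauss_square_moment :: "nat \<Rightarrow> real" where
  "gauss_square_moment m = 4 ^ m * (gauss_moment (2 * m) + 1)"

lemma gauss_moment_nonneg: "gauss_moment m \<ge> 0" "gauss_square_moment m \<ge> 0"
  by (simp_all add: gauss_moment_def gauss_square_moment_def)

lemma power_even_add_le: "(a + b) ^ (2 * m) \<le> 4 ^ m * (a ^ (2 * m) + b ^ (2 * m))" for a b :: real
proof -
  have "(a + b) ^ (2 * m) = \<bar>a + b\<bar> ^ (2 * m)" by (simp add: power_even_abs)
  also have "\<dots> \<le> (2 * max \<bar>a\<bar> \<bar>b\<bar>) ^ (2 * m)" by (intro power_mono) auto
  also have "\<dots> \<le> 4 ^ m * (a ^ (2 * m) + b ^ (2 * m))"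
    by (auto simp: power_mult_distrib max_def power_mult)
  finally show ?thesis .
qed

lemma power_even_diff_le: "(a - b) ^ (2 * m) \<le> 4 ^ m * (a ^ (2 * m) + b ^ (2 * m))" for a b :: real
  using power_even_add_le[of a "- b" m] by simp

text \<open>Both terms of \<open>cross\<close> lie between 0 and |a|^2 |b|^2, the first by
  Cauchy-Schwarz; hence so does the absolute value of their difference.\<close>

lemma abs_cross_le: "\<bar>cross p a b\<bar> \<le> (\<Sum>j<p. (a j)\<^sup>2) * (\<Sum>j<p. (b j)\<^sup>2)"
proof -
  have "\<bar>\<Sum>j<p. a j * b j\<bar> \<le> L2_set a {..<p} * L2_set b {..<p}"
    by (rule order_trans[OF sum_abs]) (simp only: abs_mult L2_set_mult_ineq)
  then have "\<bar>\<Sum>j<p. a j * b j\<bar>\<^sup>2 \<le> (L2_set a {..<p} * L2_set b {..<p})\<^sup>2"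
    by (intro power_mono) auto
  then have 1: "(\<Sum>j<p. a j * b j)\<^sup>2 \<le> (\<Sum>j<p. (a j)\<^sup>2) * (\<Sum>j<p. (b j)\<^sup>2)"
    by (simp add: L2_set_def power_mult_distrib sum_nonneg)
  have 2: "(\<Sum>j<p. (a j)\<^sup>2) * (\<Sum>j<p. (b j)\<^sup>2) / p \<le> (\<Sum>j<p. (a j)\<^sup>2) * (\<Sum>j<p. (b j)\<^sup>2)"
    by (cases p) (auto simp: divide_le_eq_1 mult_nonneg_nonneg sum_nonneg field_simps
        intro!: mult_nonneg_nonneg add_nonneg_nonneg)
  have "(\<Sum>j<p. (a j)\<^sup>2) * (\<Sum>j<p. (b j)\<^sup>2) / p \<ge> 0"
    by (intro divide_nonneg_nonneg mult_nonneg_nonneg sum_nonneg) auto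
  with 1 2 show ?thesis unfolding cross_def
    by (smt (verit) zero_le_power2)
qed

context prob_space
begin

abbreviation std_normal :: "('a \<Rightarrow> real) \<Rightarrow> bool" where
  "std_normal g \<equiv> distributed M lborel g (\<lambda>x. ennreal (std_normal_density x))"

lemma std_normal_integral:
  assumes "std_normal g" "f \<in> borel_measurable borel"
  shows "expectation (\<lambda>x. f (g x)) = (LINT x|lborel. std_normal_density x * f x)"
  using distributed_integral[OF assms(1), of f] assms(2) by simp

lemma std_normal_has_moments:
  assumes "std_normal g" shows "has_moments M g"
  unfolding has_moments_def
proof (intro conjI allI)
  show "g \<in> borel_measurable M" using distributed_measurable[OF assms] by simp
  show "integrable M (\<lambda>x. g x ^ m)" for m
    using distributed_integrable[OF assms, of "\<lambda>x. x ^ m"] integrable_std_normal_moment[of m] by simp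
qed

lemma std_normal_even_moment:
  assumes "std_normal g" shows "expectation (\<lambda>x. g x ^ (2 * m)) = gauss_moment m"
  using std_normal_integral[OF assms, of "\<lambda>x. x ^ (2 * m)"] integral_std_normal_moment_even[of m]
  by (simp add: gauss_moment_def)

lemma std_normal_odd_moment:
  assumes "std_normal g" shows "expectation (\<lambda>x. g x ^ (2 * m + 1)) = 0"
  using std_normal_integral[OF assms, of "\<lambda>x. x ^ (2 * m + 1)"] integral_std_normal_moment_odd[of m]
  by simp

lemma std_normal_low_moments:
  assumes "std_normal g"
  shows "expectation g = 0" "expectation (\<lambda>x. g x ^ 2) = 1" "expectation (\<lambda>x. g x ^ 3) = 0"
    "expectation (\<lambda>x. g x ^ 4) = 3"
  using std_normal_odd_moment[OF assms, of 0] std_normal_odd_moment[OF assms, of 1]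
    std_normal_even_moment[OF assms, of 1] std_normal_even_moment[OF assms, of 2]
  by (simp_all add: gauss_moment_def fact_numeral)

lemma std_normal_exp:
  assumes g: "std_normal g"
  shows "integrable M (\<lambda>x. exp (s * g x))" "expectation (\<lambda>x. exp (s * g x)) = exp (s\<^sup>2 / 2)"
proof -
  \<comment> \<open>Completing the square: the tilted density is a multiple of that of N(s,
    1).\<close>
  have eq: "std_normal_density x * exp (s * x) = exp (s\<^sup>2 / 2) * normal_density s 1 x" for x
    by (simp add: normal_density_def power2_eq_square field_simps flip: exp_add)
  show "integrable M (\<lambda>x. exp (s * g x))"
    using distributed_integrable[OF g, of "\<lambda>x. exp (s * x)"] by (simp add: eq)
  show "expectation (\<lambda>x. exp (s * g x)) = exp (s\<^sup>2 / 2)"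
    using std_normal_integral[OF g, of "\<lambda>x. exp (s * x)"] by (simp add: eq)
qed

lemma square_minus_one_moments:
  assumes g: "std_normal g"
  shows "has_moments M (\<lambda>x. (g x)\<^sup>2 - 1)" "expectation (\<lambda>x. (g x)\<^sup>2 - 1) = 0"
    "expectation (\<lambda>x. ((g x)\<^sup>2 - 1) ^ (2 * m)) \<le> gauss_square_moment m"
proof -
  note mom = std_normal_has_moments[OF g]
  show sq: "has_moments M (\<lambda>x. (g x)\<^sup>2 - 1)" by (intro has_moments_intros mom)
  show "expectation (\<lambda>x. (g x)\<^sup>2 - 1) = 0"
    using std_normal_low_moments(2)[OF g] has_momentsD(2)[OF mom] by (simp add: prob_space)
  have "expectation (\<lambda>x. ((g x)\<^sup>2 - 1) ^ (2 * m)) \<le> expectation (\<lambda>x. 4 ^ m * (g x ^ (2 * (2 * m)) + 1))"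
    using power_even_diff_le[of "(g x)\<^sup>2" 1 m for x]
    by (intro integral_mono has_momentsD(2)[OF sq] has_momentsD(3) has_moments_intros mom)
      (simp flip: power_mult)
  also have "\<dots> = gauss_square_moment m"
    using std_normal_even_moment[OF g, of "2 * m"] has_momentsD(2)[OF mom]
    by (simp add: gauss_square_moment_def prob_space)
  finally show "expectation (\<lambda>x. ((g x)\<^sup>2 - 1) ^ (2 * m)) \<le> gauss_square_moment m" .
qed

end

text \<open>The index type is left open so that one theory covers a single row, indexed by columns,
  and the whole matrix, indexed by pairs.\<close>

locale gaussian_vector = prob_space +
  fixes g :: "'i \<Rightarrow> 'a \<Rightarrow> real" and J :: "'i set"
  assumes fin: "finite J"
    and indep: "indep_vars (\<lambda>_. borel) g J"
    and normal: "\<And>j. j \<in> J \<Longrightarrow> std_normal (g j)"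
begin

definition lin :: "('i \<Rightarrow> real) \<Rightarrow> 'a \<Rightarrow> real" where
  "lin a x = (\<Sum>j\<in>J. a j * g j x)"

definition ip :: "('i \<Rightarrow> real) \<Rightarrow> ('i \<Rightarrow> real) \<Rightarrow> real" where
  "ip a b = (\<Sum>j\<in>J. a j * b j)"

lemma has_moments_g: "j \<in> J \<Longrightarrow> has_moments M (g j)"
  using normal std_normal_has_moments by blast

lemma has_moments_lin: "has_moments M (lin a)"
  unfolding lin_def[abs_def] by (intro has_moments_intros has_moments_g)

lemma indep_scaled: "indep_vars (\<lambda>_. borel) (\<lambda>j x. a j * g j x) J"
  by (rule indep_vars_compose2[OF indep]) auto

lemma lin_even_moment:
  "expectation (\<lambda>x. lin a x ^ (2 * q)) \<le> moment_const gauss_moment q * ip a a ^ q"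
proof -
  have "expectation (\<lambda>x. (\<Sum>j\<in>J. a j * g j x) ^ (2 * q))
      \<le> moment_const gauss_moment q * (\<Sum>j\<in>J. (a j)\<^sup>2) ^ q"
    using std_normal_low_moments(1)[OF normal] std_normal_even_moment[OF normal]
    by (intro sum_even_moment fin indep_scaled has_moments_intros has_moments_g)
      (auto simp: power_mult_distrib gauss_moment_nonneg simp flip: power_mult)
  then show ?thesis by (simp add: lin_def ip_def power2_eq_square)
qed

lemma square_sum_moment:
  "has_moments M (\<lambda>x. \<Sum>j\<in>J. (g j x)\<^sup>2 - 1)"
  "expectation (\<lambda>x. (\<Sum>j\<in>J. (g j x)\<^sup>2 - 1) ^ (2 * q)) \<le> moment_const gauss_square_moment q * real (card J) ^ q"
proof -
  show "has_moments M (\<lambda>x. \<Sum>j\<in>J. (g j x)\<^sup>2 - 1)"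
    by (intro has_moments_intros has_moments_g)
  have "indep_vars (\<lambda>_. borel) (\<lambda>j x. (g j x)\<^sup>2 - 1) J"
    by (rule indep_vars_compose2[OF indep]) auto
  then have "expectation (\<lambda>x. (\<Sum>j\<in>J. (g j x)\<^sup>2 - 1) ^ (2 * q)) \<le> moment_const gauss_square_moment q * (\<Sum>j\<in>J. 1) ^ q"
    using square_minus_one_moments[OF normal]
    by (intro sum_even_moment fin) (auto simp: gauss_moment_nonneg)
  then show "expectation (\<lambda>x. (\<Sum>j\<in>J. (g j x)\<^sup>2 - 1) ^ (2 * q)) \<le> moment_const gauss_square_moment q * real (card J) ^ q"
    by simp
qed

end

text \<open>Exact values are required here, because the leading terms of E[Z_il Z_jl] must cancel
  exactly. The induction carries mean, second and fourth moment together: in the expansion of (S +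
  X)^4 the term S^3 X dies with E X = 0 and S X^3 with E S = 0, so no third moment of S
  enters.\<close>

lemma (in gaussian_vector) lin_moments:
  "expectation (\<lambda>x. lin a x) = 0 \<and> expectation (\<lambda>x. lin a x ^ 2) = ip a a \<and> expectation (\<lambda>x. lin a x ^ 4) = 3 * (ip a a)\<^sup>2"
  using fin indep normal unfolding lin_def ip_def
proof (induction J rule: finite_induct)
  case (insert i I)
  let ?S = "\<lambda>x. \<Sum>j\<in>I. a j * g j x" and ?X = "\<lambda>x. a i * g i x" and ?s = "\<Sum>j\<in>I. a j * a j"
  have IH: "expectation ?S = 0" "expectation (\<lambda>x. ?S x ^ 2) = ?s" "expectation (\<lambda>x. ?S x ^ 4) = 3 * ?s\<^sup>2"
    using insert.IH[OF indep_vars_subset[OF insert.prems(1)]] insert.prems(2) by auto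
  have S: "has_moments M ?S"
    using insert.prems(2) by (intro has_moments_intros std_normal_has_moments) auto
  have X: "has_moments M ?X"
    using insert.prems(2) by (intro has_moments_intros std_normal_has_moments) auto
  have "indep_vars (\<lambda>_. borel) (\<lambda>j x. a j * g j x) (insert i I)"
    by (rule indep_vars_compose2[OF insert.prems(1)]) auto
  then have ind: "indep_var borel ?X borel ?S"
    using insert.hyps by (intro indep_vars_sum) auto
  have ind_pow: "expectation (\<lambda>x. ?S x ^ m * ?X x ^ n) = expectation (\<lambda>x. ?S x ^ m) * expectation (\<lambda>x. ?X x ^ n)" for m n
  proof -
    have "indep_var borel ((\<lambda>y. y ^ n) \<circ> ?X) borel ((\<lambda>y. y ^ m) \<circ> ?S)"
      by (intro indep_var_compose[OF ind]) measurable
    then have "expectation (\<lambda>x. ?X x ^ n * ?S x ^ m) = expectation (\<lambda>x. ?X x ^ n) * expectation (\<lambda>x. ?S x ^ m)"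
      by (intro indep_var_lebesgue_integral has_momentsD S X) (simp add: comp_def)
    then show ?thesis by (simp add: mult.commute)
  qed
  have i: "std_normal (g i)" using insert.prems by auto
  have X_mom: "expectation (\<lambda>x. ?X x) = 0" "expectation (\<lambda>x. ?X x ^ 2) = (a i)\<^sup>2"
    "expectation (\<lambda>x. ?X x ^ 3) = 0" "expectation (\<lambda>x. ?X x ^ 4) = 3 * a i ^ 4"
    using std_normal_low_moments[OF i] by (auto simp: power_mult_distrib)
  have int: "integrable M (\<lambda>x. ?S x ^ m * ?X x ^ n)" for m n
    by (intro has_momentsD(3) has_moments_mult has_moments_power S X)
  have 2: "expectation (\<lambda>x. (?S x + ?X x) ^ 2) = ?s + (a i)\<^sup>2"
  proof -
    have "(?S x + ?X x) ^ 2 = ?S x ^ 2 * ?X x ^ 0 + 2 * (?S x ^ 1 * ?X x ^ 1) + ?S x ^ 0 * ?X x ^ 2" for x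
      by (simp add: power2_eq_square algebra_simps)
    then have "expectation (\<lambda>x. (?S x + ?X x) ^ 2) = expectation (\<lambda>x. ?S x ^ 2 * ?X x ^ 0)
       + 2 * expectation (\<lambda>x. ?S x ^ 1 * ?X x ^ 1) + expectation (\<lambda>x. ?S x ^ 0 * ?X x ^ 2)"
      using int by (simp only: Bochner_Integration.integral_add Bochner_Integration.integrable_add
          integral_mult_right_zero integrable_mult_right)
    then show ?thesis unfolding ind_pow by (simp add: IH X_mom prob_space)
  qed
  have 4: "expectation (\<lambda>x. (?S x + ?X x) ^ 4) = 3 * ?s\<^sup>2 + 6 * ?s * (a i)\<^sup>2 + 3 * a i ^ 4"
  proof -
    have "(?S x + ?X x) ^ 4 = ?S x ^ 4 * ?X x ^ 0 + 4 * (?S x ^ 3 * ?X x ^ 1) + 6 * (?S x ^ 2 * ?X x ^ 2)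
       + 4 * (?S x ^ 1 * ?X x ^ 3) + ?S x ^ 0 * ?X x ^ 4" for x
      by (simp add: power2_eq_square eval_nat_numeral algebra_simps)
    then have "expectation (\<lambda>x. (?S x + ?X x) ^ 4) = expectation (\<lambda>x. ?S x ^ 4 * ?X x ^ 0)
       + 4 * expectation (\<lambda>x. ?S x ^ 3 * ?X x ^ 1) + 6 * expectation (\<lambda>x. ?S x ^ 2 * ?X x ^ 2)
       + 4 * expectation (\<lambda>x. ?S x ^ 1 * ?X x ^ 3) + expectation (\<lambda>x. ?S x ^ 0 * ?X x ^ 4)"
      using int by (simp only: Bochner_Integration.integral_add Bochner_Integration.integrable_add
          integral_mult_right_zero integrable_mult_right)
    then show ?thesis unfolding ind_pow by (simp add: IH X_mom std_normal_low_moments(1)[OF i] prob_space)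
  qed
  have sum: "(\<Sum>j\<in>insert i I. a j * g j x) = ?S x + ?X x" for x
    using insert.hyps by simp
  have sum_a: "(\<Sum>j\<in>insert i I. a j * a j) = ?s + (a i)\<^sup>2"
    using insert.hyps by (simp add: power2_eq_square)
  show ?case
    unfolding sum sum_a 2 4 using IH(1) X_mom(1) has_momentsD(3)[OF S] has_momentsD(3)[OF X]
    by (simp add: power2_eq_square eval_nat_numeral algebra_simps)
qed (simp_all add: prob_space)

context gaussian_vector
begin

text \<open>Polarization of $E\langle a, g\rangle^4 = 3|a|^4$.\<close>

lemma lin_square_product:
  "expectation (\<lambda>x. lin a x ^ 2 * lin b x ^ 2) = ip a a * ip b b + 2 * (ip a b)\<^sup>2"
proof -
  let ?u = "\<lambda>j. a j + b j" and ?v = "\<lambda>j. a j - b j"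
  have lin: "lin ?u x = lin a x + lin b x" "lin ?v x = lin a x - lin b x" for x
    by (simp_all add: lin_def algebra_simps sum.distrib sum_subtractf)
  have ip: "ip ?u ?u = ip a a + 2 * ip a b + ip b b" "ip ?v ?v = ip a a - 2 * ip a b + ip b b"
    by (simp_all add: ip_def algebra_simps sum.distrib sum_subtractf sum_distrib_left)
  have pol: "lin a x ^ 2 * lin b x ^ 2 = (lin ?u x ^ 4 + lin ?v x ^ 4 - 2 * lin a x ^ 4 - 2 * lin b x ^ 4) / 12" for x
    unfolding lin by (simp add: power2_eq_square eval_nat_numeral algebra_simps)
  have "expectation (\<lambda>x. lin a x ^ 2 * lin b x ^ 2) = (expectation (\<lambda>x. lin ?u x ^ 4)
      + expectation (\<lambda>x. lin ?v x ^ 4) - 2 * expectation (\<lambda>x. lin a x ^ 4) - 2 * expectation (\<lambda>x. lin b x ^ 4)) / 12"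
    unfolding pol by (simp add: has_momentsD(2)[OF has_moments_lin])
  also have "\<dots> = ip a a * ip b b + 2 * (ip a b)\<^sup>2"
    by (simp only: lin_moments ip) (simp add: power2_eq_square algebra_simps)
  finally show ?thesis .
qed

text \<open>Write |g|^2 as the sum of <e_j, g>^2 over the unit vectors and apply
  \<open>lin_square_product\<close> with b = e_j.\<close>

lemma lin_square_norm:
  "expectation (\<lambda>x. lin a x ^ 2 * (\<Sum>j\<in>J. (g j x)\<^sup>2)) = (card J + 2) * ip a a"
proof -
  let ?e = "\<lambda>j i. if i = j then 1 else 0"
  have g: "g j x = lin (?e j) x" if "j \<in> J" for j x
  proof -
    have "lin (?e j) x = (\<Sum>i\<in>J. if i = j then g j x else 0)"
      unfolding lin_def by (intro sum.cong) auto
    then show ?thesis using fin that by simp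
  qed
  have ip_e: "ip (?e j) (?e j) = 1" "ip a (?e j) = a j" if "j \<in> J" for j
    using fin that by (simp_all add: ip_def mult_if_delta if_distrib cong: if_cong)
  have "expectation (\<lambda>x. lin a x ^ 2 * (\<Sum>j\<in>J. (g j x)\<^sup>2)) = expectation (\<lambda>x. \<Sum>j\<in>J. lin a x ^ 2 * lin (?e j) x ^ 2)"
    by (simp add: sum_distrib_left g cong: sum.cong)
  also have "\<dots> = (\<Sum>j\<in>J. expectation (\<lambda>x. lin a x ^ 2 * lin (?e j) x ^ 2))"
    by (intro Bochner_Integration.integral_sum has_momentsD(3) has_moments_intros has_moments_lin)
  also have "\<dots> = (\<Sum>j\<in>J. ip a a + 2 * (a j)\<^sup>2)"
    using ip_e by (simp add: lin_square_product)
  also have "\<dots> = (card J + 2) * ip a a"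
    by (simp add: sum.distrib ip_def sum_distrib_left power2_eq_square algebra_simps)
  finally show ?thesis .
qed

text \<open>The same splitting once more: one factor |g|^2 is expanded over unit vectors and
  \<open>lin_square_norm\<close> handles each term.\<close>

lemma norm_fourth: "expectation (\<lambda>x. (\<Sum>j\<in>J. (g j x)\<^sup>2)\<^sup>2) = (card J + 2) * card J"
proof -
  let ?e = "\<lambda>j i. if i = j then 1 else 0"
  have g: "g j x = lin (?e j) x" if "j \<in> J" for j x
  proof -
    have "lin (?e j) x = (\<Sum>i\<in>J. if i = j then g j x else 0)"
      unfolding lin_def by (intro sum.cong) auto
    then show ?thesis using fin that by simp
  qed
  have ip_e: "ip (?e j) (?e j) = 1" if "j \<in> J" for j
    using fin that by (simp_all add: ip_def mult_if_delta if_distrib cong: if_cong)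
  have "expectation (\<lambda>x. (\<Sum>j\<in>J. (g j x)\<^sup>2)\<^sup>2) = expectation (\<lambda>x. \<Sum>j\<in>J. lin (?e j) x ^ 2 * (\<Sum>j\<in>J. (g j x)\<^sup>2))"
    unfolding power2_eq_square[of "\<Sum>j\<in>J. (g j x)\<^sup>2" for x]
    by (simp add: sum_distrib_right g cong: sum.cong)
  also have "\<dots> = (\<Sum>j\<in>J. expectation (\<lambda>x. lin (?e j) x ^ 2 * (\<Sum>j\<in>J. (g j x)\<^sup>2)))"
    by (intro Bochner_Integration.integral_sum has_momentsD(3) has_moments_intros has_moments_lin has_moments_g)
  also have "\<dots> = (card J + 2) * card J"
    using ip_e by (simp add: lin_square_norm) (simp add: algebra_simps)
  finally show ?thesis .
qed

end

section \<open>Moments of the traceless Gram entries\<close>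

definition cross_moment :: "nat \<Rightarrow> real" where
  "cross_moment m = 4 ^ m * (moment_const gauss_moment (2 * m) + 4 ^ m * (1 + moment_const gauss_square_moment m))"

lemma cross_moment_nonneg: "cross_moment m \<ge> 0"
  by (simp add: cross_moment_def moment_const_nonneg gauss_moment_nonneg)

lemma cross_ip:
  assumes "gaussian_vector M g {..<p}"
  shows "cross p a (\<lambda>j. g j x) = (gaussian_vector.lin g {..<p} a x)\<^sup>2
    - gaussian_vector.ip {..<p} a a * (\<Sum>j<p. (g j x)\<^sup>2) / p"
proof -
  interpret gaussian_vector M g "{..<p}" by fact
  show ?thesis by (simp add: cross_def lin_def ip_def power2_eq_square)
qed

text \<open>This is E[(g^T A g)(g^T B g)] = 2 <A, B> for the traceless parts A, B of a a^T and b
  b^T, multiplied out into the three Gaussian identities above.\<close>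

lemma cross_product_mean:
  assumes G: "gaussian_vector M g {..<p}" and p: "p > 0"
  shows "prob_space.expectation M (\<lambda>x. cross p a (\<lambda>j. g j x) * cross p b (\<lambda>j. g j x)) = 2 * cross p a b"
proof -
  interpret gaussian_vector M g "{..<p}" by fact
  let ?n = "\<lambda>x. \<Sum>j<p. (g j x)\<^sup>2"
  have n: "has_moments M ?n"
    by (intro has_moments_intros has_moments_g) auto
  have int: "integrable M (\<lambda>x. lin a x ^ 2 * lin b x ^ 2)" "integrable M (\<lambda>x. lin c x ^ 2 * ?n x)"
    "integrable M (\<lambda>x. (?n x)\<^sup>2)" for a b c
    by (intro has_momentsD(3) has_moments_mult has_moments_power has_moments_lin n)+
  have "cross p a (\<lambda>j. g j x) * cross p b (\<lambda>j. g j x) = lin a x ^ 2 * lin b x ^ 2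
      - ip b b / p * (lin a x ^ 2 * ?n x) - ip a a / p * (lin b x ^ 2 * ?n x)
      + ip a a * ip b b / p\<^sup>2 * (?n x)\<^sup>2" for x
    unfolding cross_ip[OF G] using p by (simp add: power2_eq_square field_simps)
  then have "expectation (\<lambda>x. cross p a (\<lambda>j. g j x) * cross p b (\<lambda>j. g j x))
      = ip a a * ip b b + 2 * (ip a b)\<^sup>2 - ip b b / p * ((p + 2) * ip a a)
      - ip a a / p * ((p + 2) * ip b b) + ip a a * ip b b / p\<^sup>2 * ((p + 2) * p)"
    using lin_square_product[of a b] lin_square_norm[of a] lin_square_norm[of b] norm_fourth int
    by simp
  \<comment> \<open>The coefficients of |a|^2 |b|^2 add up to 1 - 2(p+2)/p + (p+2)/p = -2/p.\<close>
  also have "\<dots> = 2 * ((ip a b)\<^sup>2 - ip a a * ip b b / p)"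
    using p by (simp add: field_simps power2_eq_square)
  also have "\<dots> = 2 * cross p a b"
    by (simp add: cross_def ip_def power2_eq_square)
  finally show ?thesis .
qed

lemma cross_has_moments:
  assumes G: "gaussian_vector M g {..<p}"
  shows "has_moments M (\<lambda>x. cross p a (\<lambda>j. g j x))"
proof -
  interpret gaussian_vector M g "{..<p}" by fact
  show ?thesis unfolding cross_ip[OF G]
    by (intro has_moments_intros has_moments_lin has_moments_g) auto
qed

text \<open>With R = |g|^2 - p the trace correction is |a|^2 (1 + R/p). As R has size sqrt p, both
  parts of \<open>cross\<close> are |a|^2 times variables whose moments are bounded uniformly in
  p.\<close>

lemma cross_even_moment:
  assumes G: "gaussian_vector M g {..<p}" and p: "p > 0"
  shows "prob_space.expectation M (\<lambda>x. cross p a (\<lambda>j. g j x) ^ (2 * m))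
    \<le> cross_moment m * (\<Sum>j<p. (a j)\<^sup>2) ^ (2 * m)"
proof -
  interpret gaussian_vector M g "{..<p}" by fact
  let ?R = "\<lambda>x. \<Sum>j<p. (g j x)\<^sup>2 - 1"
  have R: "has_moments M ?R" by (rule square_sum_moment(1))
  have le: "cross p a (\<lambda>j. g j x) ^ (2 * m)
      \<le> 4 ^ m * (lin a x ^ (2 * (2 * m)) + ip a a ^ (2 * m) * (4 ^ m * (1 + ?R x ^ (2 * m) / p ^ (2 * m))))" for x
  proof -
    have n: "(\<Sum>j<p. (g j x)\<^sup>2) / p = 1 + ?R x / p"
      using p by (simp add: sum_subtractf field_simps)
    have "cross p a (\<lambda>j. g j x) = (lin a x)\<^sup>2 - ip a a * (1 + ?R x / p)"
      unfolding cross_ip[OF G] n[symmetric] by simp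
    then have "cross p a (\<lambda>j. g j x) ^ (2 * m)
        \<le> 4 ^ m * (((lin a x)\<^sup>2) ^ (2 * m) + (ip a a * (1 + ?R x / p)) ^ (2 * m))"
      using power_even_diff_le by metis
    also have "\<dots> = 4 ^ m * (lin a x ^ (2 * (2 * m)) + ip a a ^ (2 * m) * (1 + ?R x / p) ^ (2 * m))"
      by (simp add: power_mult_distrib flip: power_mult)
    also have "\<dots> \<le> 4 ^ m * (lin a x ^ (2 * (2 * m)) + ip a a ^ (2 * m) * (4 ^ m * (1 + ?R x ^ (2 * m) / p ^ (2 * m))))"
      using power_even_add_le[of 1 "?R x / p" m]
      by (intro mult_left_mono add_left_mono) (auto simp: power_divide zero_le_even_power)
    finally show ?thesis .
  qed
  have ipn: "ip a a ^ (2 * m) \<ge> 0" by (simp add: zero_le_even_power)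
  have "expectation (\<lambda>x. cross p a (\<lambda>j. g j x) ^ (2 * m))
      \<le> expectation (\<lambda>x. 4 ^ m * (lin a x ^ (2 * (2 * m)) + ip a a ^ (2 * m) * (4 ^ m * (1 + ?R x ^ (2 * m) / p ^ (2 * m)))))"
    by (intro integral_mono le has_momentsD(3) has_moments_intros has_moments_lin R cross_has_moments G)
  also have "\<dots> = 4 ^ m * (expectation (\<lambda>x. lin a x ^ (2 * (2 * m)))
      + ip a a ^ (2 * m) * (4 ^ m * (1 + expectation (\<lambda>x. ?R x ^ (2 * m)) / p ^ (2 * m))))"
    using has_momentsD(2)[OF has_moments_lin] has_momentsD(2)[OF R] by (simp add: prob_space)
  also have "\<dots> \<le> 4 ^ m * (moment_const gauss_moment (2 * m) * ip a a ^ (2 * m)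
      + ip a a ^ (2 * m) * (4 ^ m * (1 + moment_const gauss_square_moment m)))"
  proof -
    have "expectation (\<lambda>x. ?R x ^ (2 * m)) / p ^ (2 * m) \<le> moment_const gauss_square_moment m * p ^ m / p ^ (2 * m)"
      using square_sum_moment(2)[of m] by (intro divide_right_mono) auto
    also have "\<dots> \<le> moment_const gauss_square_moment m"
    proof -
      have "real p ^ m / p ^ (2 * m) \<le> 1" using p by (simp add: power_increasing)
      then show ?thesis
        using mult_left_mono[OF _ moment_const_nonneg[of gauss_square_moment m]] gauss_moment_nonneg(2)
        by fastforce
    qed
    finally show ?thesis using lin_even_moment[of a "2 * m"] ipn
      by (intro mult_left_mono add_mono) auto
  qed
  also have "\<dots> = cross_moment m * ip a a ^ (2 * m)"
    by (simp add: cross_moment_def algebra_simps)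
  finally show ?thesis by (simp add: ip_def power2_eq_square)
qed

definition cross_product_moment :: "nat \<Rightarrow> real" where
  "cross_product_moment m = 4 ^ m * (2 * cross_moment (2 * m) * 16 ^ m + 64 ^ m)"

lemma cross_product_moment_nonneg: "cross_product_moment m \<ge> 0"
  by (simp add: cross_product_moment_def cross_moment_nonneg)

text \<open>The inequality xy <= x^2 + y^2 for nonnegative x, y decouples the two factors into
  moments of order 4m of single Gram entries. Each factor has size p and each product size p^2, so
  p^4 is the variance scale of one summand.\<close>

lemma centered_cross_product_even_moment:
  fixes a b :: "nat \<Rightarrow> real"
  assumes G: "gaussian_vector M g {..<p}" and p: "p > 0"
    and a: "(\<Sum>j<p. (a j)\<^sup>2) \<le> 2 * p" and b: "(\<Sum>j<p. (b j)\<^sup>2) \<le> 2 * p"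
  shows "prob_space.expectation M
      (\<lambda>x. (cross p a (\<lambda>j. g j x) * cross p b (\<lambda>j. g j x) - 2 * cross p a b) ^ (2 * m))
    \<le> cross_product_moment m * (real p ^ 4) ^ m"
proof -
  interpret gaussian_vector M g "{..<p}" by fact
  let ?F = "\<lambda>a x. cross p a (\<lambda>j. g j x)"
  note mom = cross_has_moments[OF G]
  have le: "(?F a x * ?F b x - 2 * cross p a b) ^ (2 * m)
      \<le> 4 ^ m * ((?F a x ^ (2 * (2 * m)) + ?F b x ^ (2 * (2 * m))) + (2 * cross p a b) ^ (2 * m))" for x
  proof -
    have "?F a x ^ (2 * m) * ?F b x ^ (2 * m) \<le> (?F a x ^ (2 * m))\<^sup>2 + (?F b x ^ (2 * m))\<^sup>2"
    proof -
      have "0 \<le> ?F a x ^ (2 * m) * ?F b x ^ (2 * m)"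
        by (intro mult_nonneg_nonneg zero_le_even_power) auto
      then show ?thesis using sum_squares_bound[of "?F a x ^ (2 * m)" "?F b x ^ (2 * m)"] by linarith
    qed
    then have "(?F a x * ?F b x) ^ (2 * m) \<le> ?F a x ^ (2 * (2 * m)) + ?F b x ^ (2 * (2 * m))"
      by (simp add: power_mult_distrib mult.commute flip: power_mult)
    then show ?thesis
      by (intro order_trans[OF power_even_diff_le] mult_left_mono add_right_mono) auto
  qed
  have pow: "(2 * real p) ^ (2 * (2 * m)) = 16 ^ m * (real p ^ 4) ^ m"
    by (simp add: power_mult power_mult_distrib)
  have Fle: "expectation (\<lambda>x. ?F c x ^ (2 * (2 * m))) \<le> cross_moment (2 * m) * (16 ^ m * (real p ^ 4) ^ m)"
    if c: "(\<Sum>j<p. (c j)\<^sup>2) \<le> 2 * p" for c :: "nat \<Rightarrow> real"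
  proof -
    have "expectation (\<lambda>x. ?F c x ^ (2 * (2 * m))) \<le> cross_moment (2 * m) * (\<Sum>j<p. (c j)\<^sup>2) ^ (2 * (2 * m))"
      by (rule cross_even_moment[OF G p])
    also have "\<dots> \<le> cross_moment (2 * m) * (2 * real p) ^ (2 * (2 * m))"
      using c by (intro mult_left_mono power_mono cross_moment_nonneg sum_nonneg) auto
    finally show ?thesis unfolding pow .
  qed
  have "\<bar>2 * cross p a b\<bar> \<le> 2 * ((\<Sum>j<p. (a j)\<^sup>2) * (\<Sum>j<p. (b j)\<^sup>2))"
    using abs_cross_le[of p a b] by simp
  also have "\<dots> \<le> 2 * ((2 * real p) * (2 * real p))"
    using a b by (intro mult_left_mono mult_mono sum_nonneg) auto
  finally have "\<bar>2 * cross p a b\<bar> ^ (2 * m) \<le> (2 * ((2 * real p) * (2 * p))) ^ (2 * m)"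
    by (intro power_mono) auto
  also have "\<dots> = 64 ^ m * (real p ^ 4) ^ m"
  proof -
    have "(2 * ((2 * real p) * (2 * real p)))\<^sup>2 = 64 * real p ^ 4"
      by (simp add: power2_eq_square eval_nat_numeral)
    then show ?thesis unfolding power_mult by (simp add: power_mult_distrib)
  qed
  finally have mean_le: "(2 * cross p a b) ^ (2 * m) \<le> 64 ^ m * (real p ^ 4) ^ m"
    by (simp add: power_even_abs)
  have "expectation (\<lambda>x. (?F a x * ?F b x - 2 * cross p a b) ^ (2 * m))
      \<le> expectation (\<lambda>x. 4 ^ m * ((?F a x ^ (2 * (2 * m)) + ?F b x ^ (2 * (2 * m))) + (2 * cross p a b) ^ (2 * m)))"
    by (intro integral_mono le has_momentsD(3) has_moments_intros mom)
  also have "\<dots> = 4 ^ m * ((expectation (\<lambda>x. ?F a x ^ (2 * (2 * m))) + expectation (\<lambda>x. ?F b x ^ (2 * (2 * m))))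
      + (2 * cross p a b) ^ (2 * m))"
    using has_momentsD(2)[OF mom] by (simp add: prob_space)
  also have "\<dots> \<le> 4 ^ m * ((cross_moment (2 * m) * (16 ^ m * (real p ^ 4) ^ m) + cross_moment (2 * m) * (16 ^ m * (real p ^ 4) ^ m))
      + 64 ^ m * (real p ^ 4) ^ m)"
    by (intro mult_left_mono add_mono Fle a b mean_le) auto
  also have "\<dots> = cross_product_moment m * (real p ^ 4) ^ m"
    by (simp add: cross_product_moment_def algebra_simps)
  finally show ?thesis .
qed

section \<open>Freezing independent variables\<close>

text \<open>Conditioning without conditional expectations: the joint law of an independent pair is a
  product measure, so by Fubini a bound for every frozen value of U survives averaging over
  U.\<close>

lemma (in prob_space) indep_var_prob_le:
  assumes ind: "indep_var S U T V" and B: "B \<in> sets (S \<Otimes>\<^sub>M T)" and \<eta>: "\<eta> \<ge> 0"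
    and le: "\<And>u. u \<in> space S \<Longrightarrow> prob {x \<in> space M. (u, V x) \<in> B} \<le> \<eta>"
  shows "prob {x \<in> space M. (U x, V x) \<in> B} \<le> \<eta>"
proof -
  have [measurable]: "U \<in> measurable M S" "V \<in> measurable M T"
    using ind by (auto dest: indep_var_rv1 indep_var_rv2)
  interpret V: prob_space "distr M T V" by (rule prob_space_distr) simp
  interpret U: prob_space "distr M S U" by (rule prob_space_distr) simp
  have slice: "emeasure (distr M T V) (Pair u -` B) \<le> ennreal \<eta>" if "u \<in> space S" for u
  proof -
    have "Pair u -` B \<in> sets T" using sets_Pair1[OF B] by auto
    then have "emeasure (distr M T V) (Pair u -` B) = emeasure M (V -` (Pair u -` B) \<inter> space M)"
      by (intro emeasure_distr) auto
    also have "V -` (Pair u -` B) \<inter> space M = {x \<in> space M. (u, V x) \<in> B}" by auto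
    finally show ?thesis using le[OF that] by (simp add: emeasure_eq_measure ennreal_leI)
  qed
  have "ennreal (prob {x \<in> space M. (U x, V x) \<in> B}) = emeasure (distr M (S \<Otimes>\<^sub>M T) (\<lambda>x. (U x, V x))) B"
    using B by (subst emeasure_distr) (auto simp: emeasure_eq_measure intro!: arg_cong[where f=prob])
  also have "distr M (S \<Otimes>\<^sub>M T) (\<lambda>x. (U x, V x)) = distr M S U \<Otimes>\<^sub>M distr M T V"
    using ind by (simp add: indep_var_distribution_eq)
  also have "emeasure (distr M S U \<Otimes>\<^sub>M distr M T V) B
      = (\<integral>\<^sup>+u. emeasure (distr M T V) (Pair u -` B) \<partial>distr M S U)"
    using B by (intro V.emeasure_pair_measure_alt) simp
  also have "\<dots> \<le> (\<integral>\<^sup>+u. ennreal \<eta> \<partial>distr M S U)"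
    using slice by (intro nn_integral_mono) auto
  also have "\<dots> = ennreal \<eta>" using U.emeasure_space_1 by simp
  finally show ?thesis using \<eta> by simp
qed

section \<open>Tail bounds for a Gaussian matrix\<close>

lemma borel_measurable_cross:
  assumes "\<And>j. j < p \<Longrightarrow> (\<lambda>z. f z j) \<in> borel_measurable N" "\<And>j. j < p \<Longrightarrow> (\<lambda>z. g z j) \<in> borel_measurable N"
  shows "(\<lambda>z. cross p (f z) (g z)) \<in> borel_measurable N"
  unfolding cross_def using assms
  by (intro borel_measurable_diff borel_measurable_divide borel_measurable_power borel_measurable_times
      borel_measurable_sum borel_measurable_const) auto

locale gaussian_matrix = prob_space +
  fixes w :: "nat \<Rightarrow> nat \<Rightarrow> 'a \<Rightarrow> real" and k p :: nat
  assumes entries_indep: "indep_vars (\<lambda>_. borel) (\<lambda>(i, j). w i j) ({..<k} \<times> {..<p})"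
    and entries_normal: "\<And>i j. \<lbrakk>i < k; j < p\<rbrakk> \<Longrightarrow> std_normal (w i j)"
    and p_pos: "p > 0"
begin

text \<open>Source of the independence of families below; the blocks are single entries, pairs of
  entries in one column, or whole rows.\<close>

lemma block_indep:
  assumes K: "\<And>l. l \<in> L \<Longrightarrow> K l \<subseteq> {..<k} \<times> {..<p}" and disj: "disjoint_family_on K L"
    and F: "\<And>l. l \<in> L \<Longrightarrow> F l \<in> borel_measurable (PiM (K l) (\<lambda>_. borel))"
  shows "indep_vars (\<lambda>_. borel) (\<lambda>l x. F l (\<lambda>(i, j)\<in>K l. w i j x)) L"
proof -
  have "indep_vars (\<lambda>j. PiM (K j) (\<lambda>_. borel)) (\<lambda>j x. restrict (\<lambda>i. (case i of (i, j) \<Rightarrow> w i j) x) (K j)) L"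
    by (rule indep_vars_restrict[OF entries_indep K disj])
  from indep_vars_compose2[OF this F] show ?thesis
    by (simp add: case_prod_beta')
qed

lemma w_measurable [measurable]: "\<lbrakk>i < k; j < p\<rbrakk> \<Longrightarrow> w i j \<in> borel_measurable M"
  using entries_normal std_normal_has_moments has_momentsD(1) by blast

lemma row_gaussian:
  assumes "i < k" shows "gaussian_vector M (w i) {..<p}"
proof
  have "indep_vars (\<lambda>_. borel) (\<lambda>j x. (\<lambda>u. u (i, j)) (\<lambda>(i, j)\<in>{(i, j)}. w i j x)) {..<p}"
    using assms by (intro block_indep) (auto simp: disjoint_family_on_def)
  then show "indep_vars (\<lambda>_. borel) (w i) {..<p}" by simp
qed (use assms entries_normal in auto)

lemma all_gaussian: "gaussian_vector M (\<lambda>(i, j). w i j) ({..<k} \<times> {..<p})"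
  by unfold_locales (use entries_indep entries_normal in auto)

lemma entry_tail:
  assumes "i < k" "j < p" "t > 0"
  shows "prob {x \<in> space M. \<bar>w i j x\<bar> > t} \<le> gauss_moment q / t ^ (2 * q)"
  using even_moment_Markov[OF std_normal_has_moments[OF entries_normal[OF assms(1,2)]] assms(3), of q]
    std_normal_even_moment[OF entries_normal[OF assms(1,2)]] by simp

lemma row_norm_tail:
  assumes "i < k" "t > 0"
  shows "prob {x \<in> space M. \<bar>(\<Sum>j<p. (w i j x)\<^sup>2) - p\<bar> > t}
    \<le> moment_const gauss_square_moment q * real p ^ q / t ^ (2 * q)"
proof -
  interpret gaussian_vector M "w i" "{..<p}" by (rule row_gaussian[OF assms(1)])
  have "prob {x \<in> space M. \<bar>\<Sum>j<p. (w i j x)\<^sup>2 - 1\<bar> > t}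
    \<le> expectation (\<lambda>x. (\<Sum>j<p. (w i j x)\<^sup>2 - 1) ^ (2 * q)) / t ^ (2 * q)"
    by (rule even_moment_Markov[OF square_sum_moment(1) assms(2)])
  also have "\<dots> \<le> moment_const gauss_square_moment q * real p ^ q / t ^ (2 * q)"
    using square_sum_moment(2)[of q] by (intro divide_right_mono) (auto simp: zero_le_even_power)
  finally show ?thesis by (simp add: sum_subtractf)
qed

text \<open>Independence acts twice: across columns it makes the summands independent, and within a
  column it factors each moment into a square of a Gaussian moment.\<close>

lemma row_product_tail:
  assumes ij: "i < k" "j < k" "i \<noteq> j" and t: "t > 0"
  shows "prob {x \<in> space M. \<bar>\<Sum>a<p. w i a x * w j a x\<bar> > t}
    \<le> moment_const (\<lambda>m. (gauss_moment m)\<^sup>2) q * real p ^ q / t ^ (2 * q)"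
proof -
  have mom: "has_moments M (w l a)" if "l < k" "a < p" for l a
    using entries_normal that std_normal_has_moments by blast
  have "indep_vars (\<lambda>_. borel) (\<lambda>a x. (\<lambda>u. u (i, a) * u (j, a)) (\<lambda>(i, j)\<in>{(i, a), (j, a)}. w i j x)) {..<p}"
  proof (rule block_indep)
    show "(\<lambda>u. u (i, a) * u (j, a) :: real) \<in> borel_measurable (PiM {(i, a), (j, a)} (\<lambda>_. borel))" for a :: nat
      by (intro borel_measurable_times measurable_component_singleton) auto
  qed (use ij in \<open>auto simp: disjoint_family_on_def\<close>)
  then have ind: "indep_vars (\<lambda>_. borel) (\<lambda>a x. w i a x * w j a x) {..<p}" by simp
  have prod_mom: "expectation (\<lambda>x. w i a x ^ m * w j a x ^ m)
      = expectation (\<lambda>x. w i a x ^ m) * expectation (\<lambda>x. w j a x ^ m)" if a: "a < p" for a m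
  proof -
    let ?X = "\<lambda>l x. (\<lambda>u. u (l, a) ^ m) (\<lambda>(i, j)\<in>{(l, a)}. w i j x)"
    have "indep_vars (\<lambda>_. borel) ?X {i, j}"
    proof (rule block_indep)
      show "(\<lambda>u. u (l, a) ^ m :: real) \<in> borel_measurable (PiM {(l, a)} (\<lambda>_. borel))" for l :: nat
        by (intro borel_measurable_power measurable_component_singleton) auto
    qed (use ij a in \<open>auto simp: disjoint_family_on_def\<close>)
    then have ind: "indep_vars (\<lambda>_. borel) (\<lambda>l x. w l a x ^ m) {i, j}" by simp
    have "expectation (\<lambda>x. \<Prod>l\<in>{i, j}. w l a x ^ m) = (\<Prod>l\<in>{i, j}. expectation (\<lambda>x. w l a x ^ m))"
      using ij a by (intro indep_vars_lebesgue_integral ind has_momentsD(2) mom) auto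
    then show ?thesis using ij by simp
  qed
  have "expectation (\<lambda>x. (\<Sum>a<p. w i a x * w j a x) ^ (2 * q))
      \<le> moment_const (\<lambda>m. (gauss_moment m)\<^sup>2) q * (\<Sum>a<p. 1) ^ q"
  proof (rule sum_even_moment[OF _ ind])
    fix a assume "a \<in> {..<p}"
    then have a: "a < p" by simp
    show "has_moments M (\<lambda>x. w i a x * w j a x)"
      using a ij by (intro has_moments_mult mom)
    show "expectation (\<lambda>x. w i a x * w j a x) = 0"
      using prod_mom[OF a, of 1] std_normal_low_moments(1)[OF entries_normal[OF ij(1) a]] by simp
    show "expectation (\<lambda>x. (w i a x * w j a x) ^ (2 * m)) \<le> (gauss_moment m)\<^sup>2 * 1 ^ m" for m
      using prod_mom[OF a, of "2 * m"] std_normal_even_moment[OF entries_normal[OF ij(1) a]]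
        std_normal_even_moment[OF entries_normal[OF ij(2) a]]
      by (simp add: power_mult_distrib power2_eq_square)
  qed auto
  moreover have "has_moments M (\<lambda>x. \<Sum>a<p. w i a x * w j a x)"
    using ij by (intro has_moments_intros mom) auto
  ultimately show ?thesis
    by (intro order_trans[OF even_moment_Markov[OF _ t, where q = q]] divide_right_mono)
      (auto simp: zero_le_even_power)
qed

text \<open>For frozen a and b the summands are centered, independent over l and of size p^2. The
  sum over at most k rows has variance scale k p^4.\<close>

lemma cross_sum_tail_fixed:
  fixes a b :: "nat \<Rightarrow> real"
  assumes L: "L \<subseteq> {..<k}" and t: "t > 0"
    and a: "(\<Sum>j<p. (a j)\<^sup>2) \<le> 2 * p" and b: "(\<Sum>j<p. (b j)\<^sup>2) \<le> 2 * p"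
  shows "prob {x \<in> space M. \<bar>\<Sum>l\<in>L. cross p a (\<lambda>j. w l j x) * cross p b (\<lambda>j. w l j x) - 2 * cross p a b\<bar> > t}
    \<le> moment_const cross_product_moment q * (k * real p ^ 4) ^ q / t ^ (2 * q)"
proof -
  let ?X = "\<lambda>l x. cross p a (\<lambda>j. w l j x) * cross p b (\<lambda>j. w l j x) - 2 * cross p a b"
  have finL: "finite L" using L finite_subset by blast
  have mom: "has_moments M (\<lambda>x. cross p c (\<lambda>j. w l j x))" if "l \<in> L" for l c
    using cross_has_moments row_gaussian that L by blast
  have momX: "has_moments M (?X l)" if "l \<in> L" for l
    using that by (intro has_moments_intros mom)
  have "indep_vars (\<lambda>_. borel) (\<lambda>l x. (\<lambda>u. cross p a (\<lambda>j. u (l, j)) * cross p b (\<lambda>j. u (l, j)) - 2 * cross p a b)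
      (\<lambda>(i, j)\<in>{l} \<times> {..<p}. w i j x)) L"
  proof (rule block_indep)
    show "(\<lambda>u. cross p a (\<lambda>j. u (l, j)) * cross p b (\<lambda>j. u (l, j)) - 2 * cross p a b)
        \<in> borel_measurable (PiM ({l} \<times> {..<p}) (\<lambda>_. borel))" for l :: nat
      by (intro borel_measurable_diff borel_measurable_times borel_measurable_const borel_measurable_cross
          measurable_component_singleton) auto
  qed (use L in \<open>auto simp: disjoint_family_on_def\<close>)
  then have ind: "indep_vars (\<lambda>_. borel) ?X L" by (simp add: cross_def)
  have "expectation (\<lambda>x. (\<Sum>l\<in>L. ?X l x) ^ (2 * q)) \<le> moment_const cross_product_moment q * (\<Sum>l\<in>L. real p ^ 4) ^ q"
  proof (rule sum_even_moment[OF finL ind momX])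
    fix l assume l: "l \<in> L"
    then have G: "gaussian_vector M (w l) {..<p}" using L row_gaussian by auto
    show "expectation (?X l) = 0"
      using cross_product_mean[OF G p_pos, of a b] has_momentsD(3)[OF has_moments_mult[OF mom mom], OF l l]
      by (simp add: prob_space)
    show "expectation (\<lambda>x. ?X l x ^ (2 * m)) \<le> cross_product_moment m * (real p ^ 4) ^ m" for m
      by (rule centered_cross_product_even_moment[OF G p_pos a b])
  qed (auto simp: cross_product_moment_nonneg)
  also have "\<dots> \<le> moment_const cross_product_moment q * (k * real p ^ 4) ^ q"
  proof -
    have "real (card L) \<le> real k" using card_mono[OF _ L] by simp
    then show ?thesis
      by (intro mult_left_mono power_mono moment_const_nonneg cross_product_moment_nonneg)
        (auto intro: mult_right_mono)
  qed
  finally have "expectation (\<lambda>x. (\<Sum>l\<in>L. ?X l x) ^ (2 * q)) \<le> moment_const cross_product_moment q * (k * real p ^ 4) ^ q" .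
  then show ?thesis
    by (intro order_trans[OF even_moment_Markov[OF has_moments_sum[OF momX] t, where q = q]] divide_right_mono)
      (auto simp: zero_le_even_power)
qed

text \<open>Rows i and j are frozen, and the rows in L are independent of them. The norm
  restrictions are part of the event, so the bound holds for every frozen value: if a row is too
  long, the slice is empty.\<close>

lemma cross_sum_tail:
  assumes ij: "i < k" "j < k" and L: "L \<subseteq> {..<k} - {i, j}" and t: "t > 0"
  shows "prob {x \<in> space M. (\<Sum>a<p. (w i a x)\<^sup>2) \<le> 2 * p \<and> (\<Sum>a<p. (w j a x)\<^sup>2) \<le> 2 * p \<and>
      \<bar>\<Sum>l\<in>L. cross p (\<lambda>a. w i a x) (\<lambda>a. w l a x) * cross p (\<lambda>a. w j a x) (\<lambda>a. w l a x)
        - 2 * cross p (\<lambda>a. w i a x) (\<lambda>a. w j a x)\<bar> > t}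
    \<le> moment_const cross_product_moment q * (k * real p ^ 4) ^ q / t ^ (2 * q)"
proof -
  let ?A = "{i, j} \<times> {..<p}" and ?B = "L \<times> {..<p}"
  let ?S = "PiM ?A (\<lambda>_. borel :: real measure)" and ?T = "PiM ?B (\<lambda>_. borel :: real measure)"
  let ?U = "\<lambda>x. restrict (\<lambda>ij. (case ij of (i, j) \<Rightarrow> w i j) x) ?A"
  let ?V = "\<lambda>x. restrict (\<lambda>ij. (case ij of (i, j) \<Rightarrow> w i j) x) ?B"
  define Bd where "Bd = {z \<in> space (?S \<Otimes>\<^sub>M ?T). (\<Sum>a<p. (fst z (i, a))\<^sup>2) \<le> 2 * p \<and> (\<Sum>a<p. (fst z (j, a))\<^sup>2) \<le> 2 * p \<and>
      \<bar>\<Sum>l\<in>L. cross p (\<lambda>a. fst z (i, a)) (\<lambda>a. snd z (l, a)) * cross p (\<lambda>a. fst z (j, a)) (\<lambda>a. snd z (l, a))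
        - 2 * cross p (\<lambda>a. fst z (i, a)) (\<lambda>a. fst z (j, a))\<bar> > t}"
  have ind: "indep_var ?S ?U ?T ?V"
    using ij L by (intro indep_var_restrict[OF entries_indep]) auto
  have fst_meas: "(\<lambda>z. fst z (l, a)) \<in> borel_measurable (?S \<Otimes>\<^sub>M ?T)" if "l \<in> {i, j}" "a < p" for l a
    using that by (intro measurable_compose[OF measurable_fst] measurable_component_singleton) auto
  have snd_meas: "(\<lambda>z. snd z (l, a)) \<in> borel_measurable (?S \<Otimes>\<^sub>M ?T)" if "l \<in> L" "a < p" for l a
    using that by (intro measurable_compose[OF measurable_snd] measurable_component_singleton) auto
  define N where "N l z = (\<Sum>a<p. (fst z (l, a))\<^sup>2)" for l and z :: "(nat \<times> nat \<Rightarrow> real) \<times> (nat \<times> nat \<Rightarrow> real)"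
  define Q where "Q z = (\<Sum>l\<in>L. cross p (\<lambda>a. fst z (i, a)) (\<lambda>a. snd z (l, a)) * cross p (\<lambda>a. fst z (j, a)) (\<lambda>a. snd z (l, a))
        - 2 * cross p (\<lambda>a. fst z (i, a)) (\<lambda>a. fst z (j, a)))" for z :: "(nat \<times> nat \<Rightarrow> real) \<times> (nat \<times> nat \<Rightarrow> real)"
  have [measurable]: "N l \<in> borel_measurable (?S \<Otimes>\<^sub>M ?T)" if "l \<in> {i, j}" for l
    unfolding N_def using that by (intro borel_measurable_sum borel_measurable_power fst_meas) auto
  have [measurable]: "Q \<in> borel_measurable (?S \<Otimes>\<^sub>M ?T)"
    unfolding Q_def
    by (intro borel_measurable_sum borel_measurable_diff borel_measurable_times borel_measurable_const
        borel_measurable_cross fst_meas snd_meas) auto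
  have Bd: "Bd \<in> sets (?S \<Otimes>\<^sub>M ?T)"
    unfolding Bd_def N_def[symmetric] Q_def[symmetric] by measurable
  have V_space: "?V x \<in> space ?T" for x by (auto simp: space_PiM)
  have eq: "{x \<in> space M. (\<Sum>a<p. (w i a x)\<^sup>2) \<le> 2 * p \<and> (\<Sum>a<p. (w j a x)\<^sup>2) \<le> 2 * p \<and>
      \<bar>\<Sum>l\<in>L. cross p (\<lambda>a. w i a x) (\<lambda>a. w l a x) * cross p (\<lambda>a. w j a x) (\<lambda>a. w l a x)
        - 2 * cross p (\<lambda>a. w i a x) (\<lambda>a. w j a x)\<bar> > t} = {x \<in> space M. (?U x, ?V x) \<in> Bd}"
    by (auto simp: Bd_def cross_def space_pair_measure space_PiM)
  show ?thesis unfolding eq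
  proof (rule indep_var_prob_le[OF ind Bd])
    show nn: "0 \<le> moment_const cross_product_moment q * (k * real p ^ 4) ^ q / t ^ (2 * q)"
      by (intro divide_nonneg_nonneg mult_nonneg_nonneg moment_const_nonneg cross_product_moment_nonneg)
        (auto simp: zero_le_even_power)
    fix u assume u: "u \<in> space ?S"
    show "prob {x \<in> space M. (u, ?V x) \<in> Bd} \<le> moment_const cross_product_moment q * (k * real p ^ 4) ^ q / t ^ (2 * q)"
    proof (cases "(\<Sum>a<p. (u (i, a))\<^sup>2) \<le> 2 * p \<and> (\<Sum>a<p. (u (j, a))\<^sup>2) \<le> 2 * p")
      case True
      have "{x \<in> space M. (u, ?V x) \<in> Bd} = {x \<in> space M. \<bar>\<Sum>l\<in>L. cross p (\<lambda>a. u (i, a)) (\<lambda>j. w l j x)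
          * cross p (\<lambda>a. u (j, a)) (\<lambda>j. w l j x) - 2 * cross p (\<lambda>a. u (i, a)) (\<lambda>a. u (j, a))\<bar> > t}"
        using u V_space True by (auto simp: Bd_def cross_def space_pair_measure)
      moreover have "L \<subseteq> {..<k}" using L by auto
      ultimately show ?thesis
        using cross_sum_tail_fixed[OF _ t, of L "\<lambda>a. u (i, a)" "\<lambda>a. u (j, a)" q] True by simp
    next
      case False
      then have empty: "{x \<in> space M. (u, ?V x) \<in> Bd} = {}" by (auto simp: Bd_def)
      show ?thesis unfolding empty using nn by simp
    qed
  qed
qed

end

section \<open>Operator norm through a fine grid\<close>

text \<open>Chernoff bound with parameter t: the exponential moment is at most exp(t^2/2), against
  exp(t^2) on the event.\<close>

lemma (in gaussian_vector) lin_exp_tail: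
  assumes a: "ip a a \<le> 1" and t: "t \<ge> 0"
  shows "prob {x \<in> space M. lin a x > t} \<le> exp (- (t\<^sup>2 / 2))"
proof -
  have ind: "indep_vars (\<lambda>_. borel) (\<lambda>j x. exp (t * a j * g j x)) J"
    by (rule indep_vars_compose2[OF indep]) auto
  have exp_lin: "exp (t * lin a x) = (\<Prod>j\<in>J. exp (t * a j * g j x))" for x
    unfolding lin_def sum_distrib_left exp_sum[OF fin] by (simp add: mult.assoc)
  have int: "integrable M (\<lambda>x. exp (t * lin a x))"
    unfolding exp_lin by (intro indep_vars_integrable fin ind std_normal_exp(1) normal)
  have "expectation (\<lambda>x. exp (t * lin a x)) = (\<Prod>j\<in>J. expectation (\<lambda>x. exp (t * a j * g j x)))"
    unfolding exp_lin by (intro indep_vars_lebesgue_integral fin ind std_normal_exp(1) normal)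
  also have "\<dots> = (\<Prod>j\<in>J. exp ((t * a j)\<^sup>2 / 2))"
    by (intro prod.cong refl std_normal_exp(2) normal)
  also have "\<dots> = exp (t\<^sup>2 * ip a a / 2)"
    by (simp add: exp_sum[OF fin, symmetric] ip_def sum_distrib_left sum_divide_distrib
        power_mult_distrib power2_eq_square mult_ac)
  also have "\<dots> \<le> exp (t\<^sup>2 / 2)" using mult_left_mono[OF a, of "t\<^sup>2"] by simp
  finally have E: "expectation (\<lambda>x. exp (t * lin a x)) \<le> exp (t\<^sup>2 / 2)" .
  have "prob {x \<in> space M. lin a x > t} \<le> prob {x \<in> space M. exp (t * lin a x) \<ge> exp (t\<^sup>2)}"
  proof (rule finite_measure_mono)
    show "{x \<in> space M. exp (t\<^sup>2) \<le> exp (t * lin a x)} \<in> events"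
      using has_momentsD(1)[OF has_moments_lin[of a]] by measurable
  qed (use t in \<open>auto simp: power2_eq_square intro: mult_left_mono\<close>)
  also have "\<dots> \<le> expectation (\<lambda>x. exp (t * lin a x)) / exp (t\<^sup>2)"
    using integral_Markov_inequality_measure[OF int, of "{}" "exp (t\<^sup>2)"] by simp
  also have "\<dots> \<le> exp (t\<^sup>2 / 2) / exp (t\<^sup>2)" using E by (intro divide_right_mono) auto
  also have "\<dots> = exp (- (t\<^sup>2 / 2))" by (simp flip: exp_diff)
  finally show ?thesis .
qed

text \<open>Multiples of 1/N in the cube [-1, 1]^n. Functions are extensional, which makes the set
  finite and countable by coordinates.\<close>

definition grid :: "nat \<Rightarrow> nat \<Rightarrow> (nat \<Rightarrow> real) set" where
  "grid N n = {..<n} \<rightarrow>\<^sub>E (\<lambda>m. of_int m / N) ` {- int N..int N}"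

lemma finite_grid: "finite (grid N n)"
  unfolding grid_def by (intro finite_PiE) auto

lemma card_grid: "card (grid N n) \<le> (2 * N + 1) ^ n"
proof -
  have "card ((\<lambda>m. of_int m / real N) ` {- int N..int N}) \<le> card {- int N..int N}"
    by (rule card_image_le) simp
  also have "\<dots> = 2 * N + 1" by simp
  finally show ?thesis unfolding grid_def by (simp add: card_PiE power_mono)
qed

text \<open>Rounding goes toward 0, so coordinates never grow in absolute value and the unit ball is
  mapped into itself.\<close>

definition truncate :: "nat \<Rightarrow> real \<Rightarrow> real" where
  "truncate N x = sgn x * of_int \<lfloor>\<bar>x\<bar> * N\<rfloor> / N"

lemma truncate:
  assumes N: "N > 0"
  shows "\<bar>truncate N x\<bar> \<le> \<bar>x\<bar>" "\<bar>x - truncate N x\<bar> \<le> 1 / N"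
    "\<bar>x\<bar> \<le> 1 \<Longrightarrow> truncate N x \<in> (\<lambda>m. of_int m / N) ` {- int N..int N}"
proof -
  let ?f = "of_int \<lfloor>\<bar>x\<bar> * N\<rfloor> :: real"
  have f: "0 \<le> ?f" "?f \<le> \<bar>x\<bar> * N" "\<bar>x\<bar> * N < ?f + 1" by auto
  have key: "\<bar>sgn x * g\<bar> \<le> \<bar>x\<bar> \<and> \<bar>x - sgn x * g\<bar> \<le> d"
    if "0 \<le> g" "g \<le> \<bar>x\<bar>" "\<bar>x\<bar> - d \<le> g" for g d :: real
    using that by (auto simp: sgn_if abs_if split: if_splits)
  have "?f / N \<le> \<bar>x\<bar>" using f(2) N by (simp add: field_simps)
  moreover have "\<bar>x\<bar> < (?f + 1) / N" using f(3) N by (simp add: pos_less_divide_eq)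
  then have "\<bar>x\<bar> - 1 / N \<le> ?f / N" by (simp add: add_divide_distrib)
  moreover have "0 \<le> ?f / N" using f(1) N by simp
  moreover have "truncate N x = sgn x * (?f / N)" by (simp add: truncate_def)
  ultimately show "\<bar>truncate N x\<bar> \<le> \<bar>x\<bar>" "\<bar>x - truncate N x\<bar> \<le> 1 / N"
    using key[of "?f / N" "1 / N"] by simp_all
  assume "\<bar>x\<bar> \<le> 1"
  then have "\<bar>x\<bar> * N \<le> N" using mult_right_mono[of "\<bar>x\<bar>" 1 "real N"] by simp
  from order_trans[OF f(2) this] have "?f \<le> of_int (int N)" by simp
  moreover define m where "m = \<lfloor>\<bar>x\<bar> * N\<rfloor>"
  ultimately have m: "0 \<le> m" "m \<le> int N" by (simp, linarith)
  have "truncate N x = of_int ((if x > 0 then 1 else if x = 0 then 0 else -1) * m) / N"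
    by (simp add: truncate_def sgn_if m_def)
  then show "truncate N x \<in> (\<lambda>m. of_int m / N) ` {- int N..int N}"
    by (rule image_eqI) (use m in auto)
qed

lemma truncate_grid:
  fixes x :: "nat \<Rightarrow> real"
  assumes N: "N > 0" and x: "(\<Sum>j<n. (x j)\<^sup>2) \<le> 1"
  shows "restrict (truncate N \<circ> x) {..<n} \<in> grid N n"
    and "(\<Sum>j<n. ((restrict (truncate N \<circ> x) {..<n}) j)\<^sup>2) \<le> 1"
    and "j < n \<Longrightarrow> \<bar>x j\<bar> \<le> 1"
proof -
  show x1: "\<bar>x j\<bar> \<le> 1" if "j < n" for j
  proof -
    have "(x j)\<^sup>2 \<le> (\<Sum>j<n. (x j)\<^sup>2)" using that by (intro member_le_sum) auto
    with x have "(x j)\<^sup>2 \<le> 1" by linarith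
    then show ?thesis by (simp add: abs_square_le_1)
  qed
  show "restrict (truncate N \<circ> x) {..<n} \<in> grid N n"
    unfolding grid_def using truncate(3)[OF N x1] by auto
  have "(\<Sum>j<n. ((restrict (truncate N \<circ> x) {..<n}) j)\<^sup>2) \<le> (\<Sum>j<n. (x j)\<^sup>2)"
    using truncate(1)[OF N] by (intro sum_mono) (simp add: abs_le_square_iff)
  with x show "(\<Sum>j<n. ((restrict (truncate N \<circ> x) {..<n}) j)\<^sup>2) \<le> 1" by linarith
qed

text \<open>The mesh is so fine that the crude bound W on the entries suffices: rounding both
  vectors alters the bilinear form by at most 2kpW/N <= 1. This is the \<open>+ 1\<close>. Duality
  and homogeneity then turn the bilinear bound into a bound on |wx|.\<close>

lemma operator_norm_from_grid:
  fixes w :: "nat \<Rightarrow> nat \<Rightarrow> real"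
  assumes N: "N > 0" and entries: "\<And>i j. \<lbrakk>i < k; j < p\<rbrakk> \<Longrightarrow> \<bar>w i j\<bar> \<le> W"
    and W: "2 * k * p * W \<le> N" and t: "t \<ge> 0"
    and net: "\<And>x y. \<lbrakk>x \<in> grid N p; y \<in> grid N k; (\<Sum>j<p. (x j)\<^sup>2) \<le> 1; (\<Sum>i<k. (y i)\<^sup>2) \<le> 1\<rbrakk>
      \<Longrightarrow> (\<Sum>i<k. \<Sum>j<p. y i * x j * w i j) \<le> t"
  shows "(\<Sum>i<k. (\<Sum>j<p. w i j * x j)\<^sup>2) \<le> (t + 1)\<^sup>2 * (\<Sum>j<p. (x j)\<^sup>2)"
proof -
  have ball: "(\<Sum>i<k. \<Sum>j<p. y i * x j * w i j) \<le> t + 1"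
    if x: "(\<Sum>j<p. (x j)\<^sup>2) \<le> 1" and y: "(\<Sum>i<k. (y i)\<^sup>2) \<le> 1" for x y :: "nat \<Rightarrow> real"
  proof -
    let ?x = "restrict (truncate N \<circ> x) {..<p}" and ?y = "restrict (truncate N \<circ> y) {..<k}"
    have diff: "y i * x j * w i j \<le> ?y i * ?x j * w i j + 2 / N * W" if i: "i < k" and j: "j < p" for i j
    proof -
      \<comment> \<open>The coordinates are replaced one after the other; each replacement costs at
        most 1/N.\<close>
      have "y i * x j - ?y i * ?x j = y i * (x j - ?x j) + (y i - ?y i) * ?x j"
        by (simp add: algebra_simps)
      then have "\<bar>y i * x j - ?y i * ?x j\<bar> \<le> \<bar>y i\<bar> * \<bar>x j - ?x j\<bar> + \<bar>y i - ?y i\<bar> * \<bar>?x j\<bar>"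
        by (metis abs_mult abs_triangle_ineq)
      also have "\<dots> \<le> 1 * (1 / N) + (1 / N) * 1"
        using truncate(2)[OF N] truncate(1)[OF N, of "x j"] truncate_grid(3)[OF N x j] truncate_grid(3)[OF N y i] i j
        by (intro add_mono mult_mono) auto
      finally have "\<bar>(y i * x j - ?y i * ?x j) * w i j\<bar> \<le> 2 / N * W"
        unfolding abs_mult[of _ "w i j"] using entries[OF i j] by (intro mult_mono) auto
      then show ?thesis by (simp add: left_diff_distrib)
    qed
    have "(\<Sum>i<k. \<Sum>j<p. y i * x j * w i j) \<le> (\<Sum>i<k. \<Sum>j<p. ?y i * ?x j * w i j + 2 / N * W)"
      by (intro sum_mono diff) auto
    also have "\<dots> = (\<Sum>i<k. \<Sum>j<p. ?y i * ?x j * w i j) + k * (p * (2 / N * W))"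
      by (simp add: sum.distrib)
    also have "k * (p * (2 / N * W)) \<le> 1" using W N by (simp add: field_simps)
    also have "(\<Sum>i<k. \<Sum>j<p. ?y i * ?x j * w i j) \<le> t"
      by (intro net truncate_grid N x y)
    finally show ?thesis by simp
  qed
  define s where "s = L2_set x {..<p}"
  have s2: "s\<^sup>2 = (\<Sum>j<p. (x j)\<^sup>2)" by (simp add: s_def L2_set_def sum_nonneg)
  show ?thesis
  proof (cases "s = 0")
    case True
    then have "x j = 0" if "j < p" for j using that by (simp add: s_def L2_set_eq_0_iff)
    then show ?thesis by simp
  next
    case False
    \<comment> \<open>\<open>u\<close> normalizes x and \<open>z\<close> is its image. Testing with
      \<open>z / Z\<close> recovers the norm \<open>Z\<close> from the bilinear form.\<close>
    define u z where "u j = x j / s" and "z i = (\<Sum>j<p. w i j * u j)" for i j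
    define Z where "Z = L2_set z {..<k}"
    have Z2: "Z\<^sup>2 = (\<Sum>i<k. (z i)\<^sup>2)" by (simp add: Z_def L2_set_def sum_nonneg)
    have u: "(\<Sum>j<p. (u j)\<^sup>2) \<le> 1"
      using False by (simp add: u_def power_divide s2 flip: sum_divide_distrib)
    have "Z \<le> t + 1"
    proof (cases "Z = 0")
      case True then show ?thesis using t by simp
    next
      case False
      have "(\<Sum>i<k. \<Sum>j<p. z i / Z * u j * w i j) = (\<Sum>i<k. (z i)\<^sup>2) / Z"
        by (simp add: z_def power2_eq_square sum_divide_distrib sum_distrib_left sum_distrib_right mult_ac)
      also have "\<dots> = Z" unfolding Z2[symmetric] using False by (simp add: power2_eq_square)
      finally show ?thesis
        using ball[OF u, of "\<lambda>i. z i / Z"] False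
        by (simp add: power_divide Z2 flip: sum_divide_distrib)
    qed
    then have "Z\<^sup>2 \<le> (t + 1)\<^sup>2" by (intro power_mono) (auto simp: Z_def)
    then have "s\<^sup>2 * Z\<^sup>2 \<le> (t + 1)\<^sup>2 * s\<^sup>2"
      using mult_right_mono[of "Z\<^sup>2" "(t + 1)\<^sup>2" "s\<^sup>2"] by (simp add: mult.commute)
    moreover have "(\<Sum>i<k. (\<Sum>j<p. w i j * x j)\<^sup>2) = s\<^sup>2 * Z\<^sup>2"
    proof -
      have "(\<Sum>j<p. w i j * x j) = s * z i" for i
        using False by (simp add: z_def u_def sum_distrib_left)
      then show ?thesis by (simp add: Z2 power_mult_distrib sum_distrib_left)
    qed
    ultimately show ?thesis by (simp add: s2)
  qed
qed

context gaussian_matrix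
begin

text \<open>The form is linear in the entries of w with coefficient matrix y u^T, whose squared
  Frobenius norm |y|^2 |u|^2 is at most 1. A union bound over pairs of grid points finishes.\<close>

lemma grid_tail:
  assumes t: "t \<ge> 0"
  shows "prob (\<Union>(u, y) \<in> {u \<in> grid N p. (\<Sum>j<p. (u j)\<^sup>2) \<le> 1} \<times> {y \<in> grid N k. (\<Sum>i<k. (y i)\<^sup>2) \<le> 1}.
      {x \<in> space M. (\<Sum>i<k. \<Sum>j<p. y i * u j * w i j x) > t})
    \<le> real ((2 * N + 1) ^ (p + k)) * exp (- (t\<^sup>2 / 2))"
proof -
  interpret gaussian_vector M "\<lambda>(i, j). w i j" "{..<k} \<times> {..<p}" by (rule all_gaussian)
  let ?I = "{u \<in> grid N p. (\<Sum>j<p. (u j)\<^sup>2) \<le> 1} \<times> {y \<in> grid N k. (\<Sum>i<k. (y i)\<^sup>2) \<le> 1}"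
  let ?E = "\<lambda>(u, y). {x \<in> space M. (\<Sum>i<k. \<Sum>j<p. y i * u j * w i j x) > t}"
  have fin: "finite ?I" using finite_grid by auto
  have "prob (\<Union>z\<in>?I. ?E z) \<le> (\<Sum>z\<in>?I. prob (?E z))"
    by (rule finite_measure_subadditive_finite[OF fin]) auto
  also have "\<dots> \<le> (\<Sum>z\<in>?I. exp (- (t\<^sup>2 / 2)))"
  proof (rule sum_mono)
    fix z assume "z \<in> ?I"
    then obtain u y where z: "z = (u, y)" "(\<Sum>j<p. (u j)\<^sup>2) \<le> 1" "(\<Sum>i<k. (y i)\<^sup>2) \<le> 1" by auto
    let ?a = "\<lambda>(i, j). y i * u j"
    have "ip ?a ?a = (\<Sum>i<k. (y i)\<^sup>2) * (\<Sum>j<p. (u j)\<^sup>2)"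
      unfolding ip_def sum_product sum.cartesian_product
      by (intro sum.cong) (auto simp: power2_eq_square)
    also have "\<dots> \<le> 1" using z by (intro mult_le_one) (auto intro: sum_nonneg)
    finally have "prob {x \<in> space M. lin ?a x > t} \<le> exp (- (t\<^sup>2 / 2))"
      by (intro lin_exp_tail t)
    moreover have "lin ?a x = (\<Sum>i<k. \<Sum>j<p. y i * u j * w i j x)" for x
      unfolding lin_def sum.cartesian_product by (intro sum.cong) auto
    ultimately show "prob (?E z) \<le> exp (- (t\<^sup>2 / 2))" using z by simp
  qed
  also have "\<dots> = card ?I * exp (- (t\<^sup>2 / 2))" by simp
  also have "\<dots> \<le> real ((2 * N + 1) ^ (p + k)) * exp (- (t\<^sup>2 / 2))"
  proof (rule mult_right_mono)
    have "card ?I \<le> card (grid N p) * card (grid N k)"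
      unfolding card_cartesian_product by (intro mult_mono card_mono finite_grid) auto
    also have "\<dots> \<le> (2 * N + 1) ^ p * (2 * N + 1) ^ k" by (intro mult_mono card_grid) auto
    finally have "card ?I \<le> (2 * N + 1) ^ (p + k)" unfolding power_add .
    then show "real (card ?I) \<le> real ((2 * N + 1) ^ (p + k))" by (rule of_nat_mono)
  qed simp
  finally show ?thesis by (simp add: case_prod_beta')
qed

end

section \<open>Fitting the ellipsoid\<close>

text \<open>The factors $p^{o(1)}$ of the sketch are fixed as $p^{1/100}$, up to constants and small powers.\<close>

definition large :: "nat \<Rightarrow> bool" where
  "large p \<longleftrightarrow> p \<ge> 2 \<and> real p powr (51/100) \<le> p / 2
    \<and> real p powr (6/5) * (4 * real p powr (51/50))\<^sup>2
        + real p powr (6/5) * (real p powr (261/100) + 8 * real p powr (6/5) * real p powr (51/50)) \<le> ((real p)\<^sup>2 / 16)\<^sup>2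
    \<and> 8 / (real p)\<^sup>2 * (2 * real p powr (-49/100)
        + 16 * real p powr (6/5) * (4 * real p powr (51/50)) * (2 * real p powr (-49/100)) / (real p)\<^sup>2)
        * (2 * real p powr (6/5) + 4 * real p powr (61/50)) \<le> 1 / p
    \<and> 2 * real p powr (6/5) * p * p \<le> real p ^ 5"

text \<open>Origin of the exponents: 51/100 is 1/2 + 1/100 and 51/50 its double; 261/100 is (6/5 +
  4)/2 + 1/100; 61/100 is (6/5)/2 + 1/100 and 61/50 its double; -49/100 is 51/100 - 1. The dominant
  powers compare as 3.81 < 4 for the norm of R, -1.05 < -1 for positivity, and 3.2 < 5 for the mesh
  of the grid.\<close>

lemma eventually_large: "eventually large sequentially"
proof -
  have "eventually (\<lambda>p::nat. p \<ge> 2) sequentially" by (rule eventually_ge_at_top)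
  moreover have "eventually (\<lambda>p::nat. real p powr (51/100) \<le> p / 2) sequentially" by real_asymp
  moreover have "eventually (\<lambda>p::nat. real p powr (6/5) * (4 * real p powr (51/50))\<^sup>2
        + real p powr (6/5) * (real p powr (261/100) + 8 * real p powr (6/5) * real p powr (51/50)) \<le> ((real p)\<^sup>2 / 16)\<^sup>2) sequentially"
    by real_asymp
  moreover have "eventually (\<lambda>p::nat. 8 / (real p)\<^sup>2 * (2 * real p powr (-49/100)
        + 16 * real p powr (6/5) * (4 * real p powr (51/50)) * (2 * real p powr (-49/100)) / (real p)\<^sup>2)
        * (2 * real p powr (6/5) + 4 * real p powr (61/50)) \<le> 1 / p) sequentially"
    by real_asymp
  moreover have "eventually (\<lambda>p::nat. 2 * real p powr (6/5) * p * p \<le> real p ^ 5) sequentially" by real_asymp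
  ultimately show ?thesis unfolding large_def by eventually_elim blast
qed

lemma quad_form_scale: "quad_form p Y (\<lambda>j. c * z j) = c\<^sup>2 * quad_form p Y z"
  unfolding quad_form_def sum_distrib_left by (simp add: power2_eq_square mult_ac)

text \<open>A difference of two nonnegative numbers is at most the larger one in absolute
  value.\<close>

lemma abs_cross_le_max:
  assumes p: "p > 0" and ab: "\<bar>\<Sum>j<p. a j * b j\<bar> \<le> c" and a: "(\<Sum>j<p. (a j)\<^sup>2) \<le> 2 * real p"
    and b: "(\<Sum>j<p. (b j)\<^sup>2) \<le> 2 * real p"
  shows "\<bar>cross p a b\<bar> \<le> max (c\<^sup>2) (4 * p)"
proof -
  have "(\<Sum>j<p. a j * b j)\<^sup>2 \<le> c\<^sup>2"
    using power_mono[OF ab, of 2] by simp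
  moreover have "(\<Sum>j<p. (a j)\<^sup>2) * (\<Sum>j<p. (b j)\<^sup>2) \<le> (2 * real p) * (2 * real p)"
    using a b by (intro mult_mono sum_nonneg) auto
  then have "(\<Sum>j<p. (a j)\<^sup>2) * (\<Sum>j<p. (b j)\<^sup>2) / p \<le> 4 * p"
    using p by (simp add: field_simps)
  moreover have "(\<Sum>j<p. (a j)\<^sup>2) * (\<Sum>j<p. (b j)\<^sup>2) / p \<ge> 0"
    by (intro divide_nonneg_nonneg mult_nonneg_nonneg sum_nonneg) auto
  moreover have "(\<Sum>j<p. a j * b j)\<^sup>2 \<ge> 0" by simp
  ultimately show ?thesis unfolding cross_def by linarith
qed

definition typical :: "nat \<Rightarrow> nat \<Rightarrow> (nat \<Rightarrow> nat \<Rightarrow> real) \<Rightarrow> bool" where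
  "typical p k w \<longleftrightarrow>
    (\<forall>i<k. \<bar>(\<Sum>j<p. (w i j)\<^sup>2) - p\<bar> \<le> real p powr (51/100)) \<and>
    (\<forall>i<k. \<forall>j<k. i \<noteq> j \<longrightarrow> \<bar>\<Sum>a<p. w i a * w j a\<bar> \<le> real p powr (51/100)) \<and>
    (\<forall>i<k. \<forall>j<k. i \<noteq> j \<longrightarrow> (\<Sum>a<p. (w i a)\<^sup>2) \<le> 2 * p \<longrightarrow> (\<Sum>a<p. (w j a)\<^sup>2) \<le> 2 * p \<longrightarrow>
      \<bar>\<Sum>l\<in>{..<k} - {i, j}. cross p (w i) (w l) * cross p (w j) (w l) - 2 * cross p (w i) (w j)\<bar>
        \<le> real p powr (261/100)) \<and>
    (\<forall>i<k. \<forall>j<p. \<bar>w i j\<bar> \<le> p) \<and>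
    (\<forall>u\<in>grid (p ^ 5) p. \<forall>y\<in>grid (p ^ 5) k. (\<Sum>j<p. (u j)\<^sup>2) \<le> 1 \<longrightarrow> (\<Sum>i<k. (y i)\<^sup>2) \<le> 1 \<longrightarrow>
      (\<Sum>i<k. \<Sum>j<p. y i * u j * w i j) \<le> real p powr (61/100))"

lemma ellipsoid_fit:
  fixes w :: "nat \<Rightarrow> nat \<Rightarrow> real" and \<pi> :: "nat \<Rightarrow> real" and k p :: nat
  assumes large: "large p" and k: "real k \<le> real p powr (6/5)"
    and typical: "typical p k w"
    and scale: "\<And>i. i < k \<Longrightarrow> \<bar>1 / (\<pi> i)\<^sup>2 - 1\<bar> \<le> real p powr (-49/100)"
  shows "\<exists>Y. symmetric_psd p Y \<and> (\<forall>i<k. quad_form p Y (\<lambda>j. \<pi> i * w i j) = 1)"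
proof -
  let ?P = "real p" and ?\<kappa> = "real p powr (6/5)"
  note conds = typical[unfolded typical_def]
  have norms: "\<bar>(\<Sum>j<p. (w i j)\<^sup>2) - p\<bar> \<le> real p powr (51/100)" if "i < k" for i
    using conds that by blast
  have prods: "\<bar>\<Sum>a<p. w i a * w j a\<bar> \<le> real p powr (51/100)" if "i < k" "j < k" "i \<noteq> j" for i j
    using conds that by blast
  have sums: "\<bar>\<Sum>l\<in>{..<k} - {i, j}. cross p (w i) (w l) * cross p (w j) (w l) - 2 * cross p (w i) (w j)\<bar>
        \<le> real p powr (261/100)"
    if "i < k" "j < k" "i \<noteq> j" "(\<Sum>a<p. (w i a)\<^sup>2) \<le> 2 * p" "(\<Sum>a<p. (w j a)\<^sup>2) \<le> 2 * p" for i j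
    using conds that by blast
  have entries: "\<bar>w i j\<bar> \<le> p" if "i < k" "j < p" for i j
    using conds that by blast
  have net: "(\<Sum>i<k. \<Sum>j<p. y i * x j * w i j) \<le> real p powr (61/100)"
    if "x \<in> grid (p ^ 5) p" "y \<in> grid (p ^ 5) k" "(\<Sum>j<p. (x j)\<^sup>2) \<le> 1" "(\<Sum>i<k. (y i)\<^sup>2) \<le> 1" for x y
    using conds that by blast
  have P: "?P \<ge> 2" "p > 0" and L: "?P powr (51/100) \<le> ?P / 2"
    "?\<kappa> * (4 * ?P powr (51/50))\<^sup>2 + ?\<kappa> * (?P powr (261/100) + 8 * ?\<kappa> * ?P powr (51/50)) \<le> (?P\<^sup>2 / 16)\<^sup>2"
    "8 / ?P\<^sup>2 * (2 * ?P powr (-49/100) + 16 * ?\<kappa> * (4 * ?P powr (51/50)) * (2 * ?P powr (-49/100)) / ?P\<^sup>2)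
        * (2 * ?\<kappa> + 4 * ?P powr (61/50)) \<le> 1 / p"
    "2 * ?\<kappa> * p * p \<le> ?P ^ 5"
    using large unfolding large_def by auto
  let ?n = "\<lambda>i. \<Sum>j<p. (w i j)\<^sup>2"
  \<comment> \<open>\<open>e\<close> covers both (p^{51/100})^2 and 4p. \<open>s\<close> adds to the
    fluctuation at most k conditional means of size 2e. \<open>\<tau>\<close> sums two errors
    p^{-49/100}, one from the scaling and one from n_i/p. The 1 in \<open>T\<close> is the rounding
    error of the grid.\<close>
  define e where "e = 4 * ?P powr (51/50)"
  define s where "s = ?P powr (261/100) + 2 * k * e"
  define \<tau> where "\<tau> = 2 * ?P powr (-49/100)"
  define T where "T = (?P powr (61/100) + 1)\<^sup>2"
  have n: "p / 2 \<le> ?n i \<and> ?n i \<le> 2 * p" if "i < k" for i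
    using norms[OF that] L(1) by linarith
  have e: "\<bar>cross p (w i) (w j)\<bar> \<le> e" if "i < k" "j < k" "i \<noteq> j" for i j
  proof -
    have "\<bar>cross p (w i) (w j)\<bar> \<le> max ((?P powr (51/100))\<^sup>2) (4 * p)"
      using n[OF that(1)] n[OF that(2)] by (intro abs_cross_le_max P prods that) auto
    also have "(?P powr (51/100))\<^sup>2 = ?P powr (51/50)"
      by (simp add: power2_eq_square flip: powr_add)
    also have "max (?P powr (51/50)) (4 * p) \<le> e"
    proof -
      have "?P powr 1 \<le> ?P powr (51/50)" using P by (intro powr_mono) auto
      then show ?thesis unfolding e_def using P by simp
    qed
    finally show ?thesis .
  qed
  have e0: "e \<ge> 0" by (simp add: e_def)
  have s: "\<bar>\<Sum>l\<in>{..<k} - {i, j}. cross p (w i) (w l) * cross p (w j) (w l)\<bar> \<le> s"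
    if ij: "i < k" "j < k" "i \<noteq> j" for i j
  proof -
    let ?L = "{..<k} - {i, j}"
    have "(\<Sum>l\<in>?L. cross p (w i) (w l) * cross p (w j) (w l))
      = (\<Sum>l\<in>?L. cross p (w i) (w l) * cross p (w j) (w l) - 2 * cross p (w i) (w j)) + card ?L * (2 * cross p (w i) (w j))"
      by (simp add: sum_subtractf)
    moreover have "\<bar>card ?L * (2 * cross p (w i) (w j))\<bar> \<le> k * (2 * e)"
    proof -
      have "card ?L \<le> k" using card_mono[of "{..<k}" ?L] by auto
      then show ?thesis using e[OF ij] e0 unfolding abs_mult by (intro mult_mono) auto
    qed
    moreover have "\<bar>\<Sum>l\<in>?L. cross p (w i) (w l) * cross p (w j) (w l) - 2 * cross p (w i) (w j)\<bar> \<le> ?P powr (261/100)"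
      using n[OF ij(1)] n[OF ij(2)] by (intro sums ij) auto
    ultimately show ?thesis unfolding s_def by linarith
  qed
  have T_le: "T \<le> 4 * ?P powr (61/50)"
  proof -
    have "1 \<le> ?P powr (61/100)" using P by (intro ge_one_powr_ge_zero) auto
    then have "T \<le> (2 * ?P powr (61/100))\<^sup>2" unfolding T_def by (intro power_mono) auto
    also have "\<dots> = 4 * ?P powr (61/50)" by (simp add: power2_eq_square flip: powr_add)
    finally show ?thesis .
  qed
  have op: "(\<Sum>i<k. (\<Sum>j<p. w i j * x j)\<^sup>2) \<le> T * (\<Sum>j<p. (x j)\<^sup>2)" for x
    unfolding T_def
  proof (rule operator_norm_from_grid[where N = "p ^ 5" and W = p])
    have "2 * real k * p * p \<le> 2 * ?\<kappa> * p * p"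
      using k by (intro mult_right_mono mult_left_mono) auto
    with L(4) show "real (2 * k * p) * real p \<le> real (p ^ 5)" by simp
  qed (use P entries net in auto)
  have small: "k * e\<^sup>2 + k * s \<le> (?P\<^sup>2 / 16)\<^sup>2"
  proof -
    have "k * e\<^sup>2 + k * s \<le> ?\<kappa> * e\<^sup>2 + ?\<kappa> * (?P powr (261/100) + 2 * ?\<kappa> * e)"
      unfolding s_def using k e0 by (intro add_mono mult_mono) auto
    also have "\<dots> \<le> (?P\<^sup>2 / 16)\<^sup>2" using L(2) by (simp add: e_def mult_ac)
    finally show ?thesis .
  qed
  have fin: "8 / ?P\<^sup>2 * (\<tau> + 16 * k * e * \<tau> / ?P\<^sup>2) * (2 * k + T) \<le> 1 / p"
  proof -
    have "8 / ?P\<^sup>2 * (\<tau> + 16 * k * e * \<tau> / ?P\<^sup>2) * (2 * k + T)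
        \<le> 8 / ?P\<^sup>2 * (\<tau> + 16 * ?\<kappa> * e * \<tau> / ?P\<^sup>2) * (2 * ?\<kappa> + 4 * ?P powr (61/50))"
      using k e0 T_le
      by (intro mult_mono add_mono divide_right_mono order_refl) (auto simp: \<tau>_def T_def)
    also have "\<dots> \<le> 1 / p" using L(3) by (simp only: e_def \<tau>_def)
    finally show ?thesis .
  qed
  have b: "\<bar>1 / (\<pi> i)\<^sup>2 - ?n i / p\<bar> \<le> \<tau>" if i: "i < k" for i
  proof -
    have "?n i / p - 1 = (?n i - p) / p" using P by (simp add: diff_divide_distrib)
    then have "\<bar>?n i / p - 1\<bar> = \<bar>?n i - p\<bar> / p" by (simp add: abs_divide)
    also have "\<dots> \<le> ?P powr (51/100) / p" using norms[OF i] by (intro divide_right_mono) auto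
    also have "\<dots> = ?P powr (-49/100)" using P powr_diff[of ?P "51/100" 1] by simp
    finally show ?thesis using scale[OF i] unfolding \<tau>_def by linarith
  qed
  obtain Y where Y: "symmetric_psd p Y" "\<And>i. i < k \<Longrightarrow> quad_form p Y (w i) = 1 / (\<pi> i)\<^sup>2"
    using ellipsoid_of_weak_correlation[of p k w e s \<tau> T "\<lambda>i. 1 / (\<pi> i)\<^sup>2"] n e s small e0 op b fin P
    by (auto simp: s_def \<tau>_def T_def)
  \<comment> \<open>Since 1/0 = 0, a vanishing \<open>\<pi> i\<close> would make the left side of
    \<open>scale\<close> equal to 1, while the right side is below 1. Nonvanishing is needed to
    cancel \<open>\<pi> i\<close> in the scaled form.\<close>
  have "\<pi> i \<noteq> 0" if "i < k" for i
  proof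
    assume "\<pi> i = 0"
    then have "1 \<le> ?P powr (-49/100)" using scale[OF that] by simp
    moreover have "?P powr (-49/100) < 1" using P by (intro powr_less_one) auto
    ultimately show False by simp
  qed
  then have "quad_form p Y (\<lambda>j. \<pi> i * w i j) = 1" if "i < k" for i
    using Y(2)[OF that] that by (simp add: quad_form_scale)
  with Y(1) show ?thesis by blast
qed

section \<open>Probability of the typical event\<close>

lemma (in prob_space) prob_UN_le:
  fixes \<eta> :: real
  assumes "finite I" "\<And>i. i \<in> I \<Longrightarrow> E i \<in> events" "\<And>i. i \<in> I \<Longrightarrow> prob (E i) \<le> \<eta>"
  shows "prob (\<Union>i\<in>I. E i) \<le> card I * \<eta>"
proof -
  have "prob (\<Union>i\<in>I. E i) \<le> (\<Sum>i\<in>I. prob (E i))"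
    by (rule finite_measure_subadditive_finite) (use assms in auto)
  also have "\<dots> \<le> (\<Sum>i\<in>I. \<eta>)" using assms by (intro sum_mono) auto
  finally show ?thesis by simp
qed

definition tail_const :: "nat \<Rightarrow> real" where
  "tail_const q = gauss_moment q + moment_const gauss_square_moment q
    + moment_const (\<lambda>m. (gauss_moment m)\<^sup>2) q + moment_const cross_product_moment q"

lemma tail_const_ge:
  "gauss_moment q \<le> tail_const q" "moment_const gauss_square_moment q \<le> tail_const q"
  "moment_const (\<lambda>m. (gauss_moment m)\<^sup>2) q \<le> tail_const q"
  "moment_const cross_product_moment q \<le> tail_const q" "tail_const q \<ge> 0"
proof -
  have "moment_const gauss_square_moment q \<ge> 0" "moment_const (\<lambda>m. (gauss_moment m)\<^sup>2) q \<ge> 0"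
    "moment_const cross_product_moment q \<ge> 0" "gauss_moment q \<ge> 0"
    by (auto intro!: moment_const_nonneg simp: gauss_moment_nonneg cross_product_moment_nonneg)
  then show "gauss_moment q \<le> tail_const q" "moment_const gauss_square_moment q \<le> tail_const q"
    "moment_const (\<lambda>m. (gauss_moment m)\<^sup>2) q \<le> tail_const q"
    "moment_const cross_product_moment q \<le> tail_const q" "tail_const q \<ge> 0"
    by (simp_all add: tail_const_def)
qed

context gaussian_matrix
begin

text \<open>In the first three families the threshold exceeds the natural scale by at least
  p^{1/100}, so the 2q-th moment leaves p^{-q/50}; the entry bound p decays faster still. There are
  at most 4 p^4 such events because k <= p^2. The grid is charged separately through its exponential
  tail.\<close>

lemma typical_vhp:
  assumes k: "real k \<le> real p powr (6/5)"
  shows "\<exists>A\<in>events. (\<forall>x\<in>A. x \<in> space M \<and> typical p k (\<lambda>i j. w i j x)) \<and>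
    prob A \<ge> 1 - (4 * real p ^ 4 * (tail_const q * real p powr (- (q / 50)))
      + real ((2 * p ^ 5 + 1) ^ (p + k)) * exp (- ((real p powr (61/100))\<^sup>2 / 2)))"
proof -
  define \<eta> where "\<eta> = tail_const q * real p powr (- (q / 50))"
  have P: "real p \<ge> 1" using p_pos by simp
  define B1 where "B1 i = {x \<in> space M. \<bar>(\<Sum>j<p. (w i j x)\<^sup>2) - p\<bar> > real p powr (51/100)}" for i
  define B2 where "B2 ij = {x \<in> space M. \<bar>\<Sum>a<p. w (fst ij) a x * w (snd ij) a x\<bar> > real p powr (51/100)}" for ij
  define B3 where "B3 ij = {x \<in> space M. (\<Sum>a<p. (w (fst ij) a x)\<^sup>2) \<le> 2 * p \<and> (\<Sum>a<p. (w (snd ij) a x)\<^sup>2) \<le> 2 * p \<and>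
      \<bar>\<Sum>l\<in>{..<k} - {fst ij, snd ij}. cross p (\<lambda>a. w (fst ij) a x) (\<lambda>a. w l a x) * cross p (\<lambda>a. w (snd ij) a x) (\<lambda>a. w l a x)
        - 2 * cross p (\<lambda>a. w (fst ij) a x) (\<lambda>a. w (snd ij) a x)\<bar> > real p powr (261/100)}" for ij
  define B4 where "B4 ij = {x \<in> space M. \<bar>w (fst ij) (snd ij) x\<bar> > real p}" for ij
  define B5 where "B5 = (\<Union>(u, y) \<in> {u \<in> grid (p ^ 5) p. (\<Sum>j<p. (u j)\<^sup>2) \<le> 1} \<times> {y \<in> grid (p ^ 5) k. (\<Sum>i<k. (y i)\<^sup>2) \<le> 1}.
      {x \<in> space M. (\<Sum>i<k. \<Sum>j<p. y i * u j * w i j x) > real p powr (61/100)})"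
  define I where "I = {ij \<in> {..<k} \<times> {..<k}. fst ij \<noteq> snd ij}"
  have pow: "(real p powr a) ^ n = real p powr (a * n)" for a n
    using P by (subst powr_realpow[symmetric]) (auto simp: powr_powr)
  \<comment> \<open>Variance scale p against threshold p^{51/100}: the exponent is q -
    51q/50.\<close>
  have "real p ^ q / (real p powr (51/100)) ^ (2 * q) = real p powr q / real p powr (51/100 * real (2 * q))"
    unfolding pow using P by (subst powr_realpow) auto
  also have "\<dots> = real p powr (- (q / 50))"
    unfolding powr_diff[symmetric] by (rule arg_cong[where f="\<lambda>a. real p powr a"]) simp
  finally have decay: "real p ^ q / (real p powr (51/100)) ^ (2 * q) = real p powr (- (q / 50))" .
  have B1: "B1 i \<in> events" if "i < k" for i
  proof -
    have [measurable]: "(\<lambda>x. \<Sum>j<p. (w i j x)\<^sup>2) \<in> borel_measurable M"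
      using that by (intro borel_measurable_sum borel_measurable_power w_measurable) auto
    show ?thesis unfolding B1_def by measurable
  qed
  have B2: "B2 ij \<in> events" if "ij \<in> I" for ij
  proof -
    have [measurable]: "(\<lambda>x. \<Sum>a<p. w (fst ij) a x * w (snd ij) a x) \<in> borel_measurable M"
      using that by (intro borel_measurable_sum borel_measurable_times w_measurable) (auto simp: I_def)
    show ?thesis unfolding B2_def by measurable
  qed
  have B3: "B3 ij \<in> events" if "ij \<in> I" for ij
  proof -
    have ij: "fst ij < k" "snd ij < k" using that by (auto simp: I_def)
    have [measurable]: "(\<lambda>x. \<Sum>a<p. (w l a x)\<^sup>2) \<in> borel_measurable M" if "l < k" for l
      using that by (intro borel_measurable_sum borel_measurable_power w_measurable) auto
    have [measurable]: "(\<lambda>x. \<Sum>l\<in>{..<k} - {fst ij, snd ij}. cross p (\<lambda>a. w (fst ij) a x) (\<lambda>a. w l a x) * cross p (\<lambda>a. w (snd ij) a x) (\<lambda>a. w l a x)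
        - 2 * cross p (\<lambda>a. w (fst ij) a x) (\<lambda>a. w (snd ij) a x)) \<in> borel_measurable M"
      using ij by (intro borel_measurable_sum borel_measurable_diff borel_measurable_times borel_measurable_const
        borel_measurable_cross w_measurable) auto
    show ?thesis unfolding B3_def using ij by measurable
  qed
  have B4: "B4 ij \<in> events" if "ij \<in> {..<k} \<times> {..<p}" for ij
  proof -
    have [measurable]: "w (fst ij) (snd ij) \<in> borel_measurable M" using that by (intro w_measurable) auto
    show ?thesis unfolding B4_def by measurable
  qed
  have [measurable]: "(\<lambda>x. \<Sum>i<k. \<Sum>j<p. y i * u j * w i j x) \<in> borel_measurable M" for u y
    by (intro borel_measurable_sum borel_measurable_times borel_measurable_const w_measurable) auto
  have B5: "B5 \<in> events"
    unfolding B5_def case_prod_beta'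
    by (rule sets.finite_UN) (simp add: finite_grid, measurable)
  have 1: "prob (\<Union>i\<in>{..<k}. B1 i) \<le> card {..<k} * \<eta>"
  proof (rule prob_UN_le)
    fix i assume "i \<in> {..<k}"
    then have "prob (B1 i) \<le> moment_const gauss_square_moment q * real p ^ q / (real p powr (51/100)) ^ (2 * q)"
      unfolding B1_def using P by (intro row_norm_tail) auto
    also have "\<dots> = moment_const gauss_square_moment q * real p powr (- (q / 50))"
      unfolding decay[symmetric] by simp
    also have "\<dots> \<le> \<eta>" unfolding \<eta>_def by (intro mult_right_mono tail_const_ge) auto
    finally show "prob (B1 i) \<le> \<eta>" .
  qed (use B1 in auto)
  have finI: "finite I" by (simp add: I_def)
  have 2: "prob (\<Union>ij\<in>I. B2 ij) \<le> card I * \<eta>"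
  proof (rule prob_UN_le[OF finI])
    fix ij assume "ij \<in> I"
    then have "prob (B2 ij) \<le> moment_const (\<lambda>m. (gauss_moment m)\<^sup>2) q * real p ^ q / (real p powr (51/100)) ^ (2 * q)"
      unfolding B2_def using P by (intro row_product_tail) (auto simp: I_def)
    also have "\<dots> = moment_const (\<lambda>m. (gauss_moment m)\<^sup>2) q * real p powr (- (q / 50))"
      unfolding decay[symmetric] by simp
    also have "\<dots> \<le> \<eta>" unfolding \<eta>_def by (intro mult_right_mono tail_const_ge) auto
    finally show "prob (B2 ij) \<le> \<eta>" .
  qed (use B2 in auto)
  have 3: "prob (\<Union>ij\<in>I. B3 ij) \<le> card I * \<eta>"
  proof (rule prob_UN_le[OF finI])
    fix ij assume "ij \<in> I"
    then have "prob (B3 ij) \<le> moment_const cross_product_moment q * (k * real p ^ 4) ^ q / (real p powr (261/100)) ^ (2 * q)"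
      unfolding B3_def using P by (intro cross_sum_tail) (auto simp: I_def)
    also have "\<dots> \<le> moment_const cross_product_moment q * (real p powr (26/5)) ^ q / (real p powr (261/100)) ^ (2 * q)"
    proof -
      have "real k * real p ^ 4 \<le> real p powr (6/5) * real p ^ 4"
        using k by (intro mult_right_mono) auto
      also have "real p ^ 4 = real p powr 4" using P by (simp add: powr_numeral)
      also have "real p powr (6/5) * real p powr 4 = real p powr (26/5)"
        unfolding powr_add[symmetric] by simp
      finally show ?thesis
        by (intro divide_right_mono mult_left_mono power_mono moment_const_nonneg cross_product_moment_nonneg) auto
    qed
    also have "\<dots> = moment_const cross_product_moment q * real p powr (- (q / 50))"
    proof -
      \<comment> \<open>Variance scale k p^4 <= p^{26/5} against threshold p^{261/100}: the exponent
        is 260q/50 - 261q/50, the same as before.\<close>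
      have "(real p powr (26/5)) ^ q / (real p powr (261/100)) ^ (2 * q) = real p powr (- (q / 50))"
        unfolding pow powr_diff[symmetric] by (rule arg_cong[where f="\<lambda>a. real p powr a"]) simp
      then show ?thesis by (simp only: times_divide_eq_right[symmetric])
    qed
    also have "\<dots> \<le> \<eta>" unfolding \<eta>_def by (intro mult_right_mono tail_const_ge) auto
    finally show "prob (B3 ij) \<le> \<eta>" .
  qed (use B3 in auto)
  have 4: "prob (\<Union>ij\<in>{..<k} \<times> {..<p}. B4 ij) \<le> card ({..<k} \<times> {..<p}) * \<eta>"
  proof (rule prob_UN_le)
    fix ij assume "ij \<in> {..<k} \<times> {..<p}"
    then have "prob (B4 ij) \<le> gauss_moment q / real p ^ (2 * q)"
      unfolding B4_def using P by (intro entry_tail) auto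
    also have "\<dots> = gauss_moment q * real p powr (- real (2 * q))"
      using P powr_realpow[of "real p" "2 * q"] by (simp add: powr_minus divide_inverse)
    also have "\<dots> \<le> \<eta>" unfolding \<eta>_def
      using P by (intro mult_mono powr_mono tail_const_ge) auto
    finally show "prob (B4 ij) \<le> \<eta>" .
  qed (use B4 in auto)
  have 5: "prob B5 \<le> real ((2 * p ^ 5 + 1) ^ (p + k)) * exp (- ((real p powr (61/100))\<^sup>2 / 2))"
    unfolding B5_def by (rule grid_tail) simp
  define B where "B = (\<Union>i\<in>{..<k}. B1 i) \<union> (\<Union>ij\<in>I. B2 ij) \<union> (\<Union>ij\<in>I. B3 ij) \<union> (\<Union>ij\<in>{..<k} \<times> {..<p}. B4 ij) \<union> B5"
  have U: "(\<Union>i\<in>{..<k}. B1 i) \<in> events" "(\<Union>ij\<in>I. B2 ij) \<in> events" "(\<Union>ij\<in>I. B3 ij) \<in> events"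
    "(\<Union>ij\<in>{..<k} \<times> {..<p}. B4 ij) \<in> events" "B5 \<in> events"
    using finI B1 B2 B3 B4 B5 by (auto intro!: sets.finite_UN)
  have B: "B \<in> events" unfolding B_def using U by (intro sets.Un)
  have "prob B \<le> prob (\<Union>i\<in>{..<k}. B1 i) + prob (\<Union>ij\<in>I. B2 ij) + prob (\<Union>ij\<in>I. B3 ij)
      + prob (\<Union>ij\<in>{..<k} \<times> {..<p}. B4 ij) + prob B5"
    unfolding B_def using U
    by (intro order_trans[OF measure_Un_le] add_right_mono order_refl sets.Un)
  also have "\<dots> \<le> card {..<k} * \<eta> + card I * \<eta> + card I * \<eta> + card ({..<k} \<times> {..<p}) * \<eta>
      + real ((2 * p ^ 5 + 1) ^ (p + k)) * exp (- ((real p powr (61/100))\<^sup>2 / 2))"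
    by (intro add_mono 1 2 3 4 5)
  also have "card {..<k} * \<eta> + card I * \<eta> + card I * \<eta> + card ({..<k} \<times> {..<p}) * \<eta> \<le> 4 * real p ^ 4 * \<eta>"
  proof -
    have "real p powr (6/5) \<le> real p powr 2" using P by (intro powr_mono) auto
    also have "\<dots> = real p ^ 2" using P by (simp add: powr_numeral)
    finally have k2: "real k \<le> real p ^ 2" using k by linarith
    have p4: "real p ^ 2 * real p ^ 2 = real p ^ 4" by (simp flip: power_add)
    have "real p ^ 2 \<le> real p ^ 4" "real p ^ 1 \<le> real p ^ 2" using P by (intro power_increasing; simp)+
    moreover have "real k * real k \<le> real p ^ 2 * real p ^ 2" using k2 by (intro mult_mono) auto
    moreover have "card I \<le> k * k"
      using card_mono[of "{..<k} \<times> {..<k}" I] by (auto simp: I_def)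
    then have "real (card I) \<le> real k * real k" by (metis of_nat_mono of_nat_mult)
    moreover have "real k * real p \<le> real p ^ 2 * real p ^ 2"
      using k2 \<open>real p ^ 1 \<le> real p ^ 2\<close> by (intro mult_mono) auto
    ultimately have "real (card {..<k}) + card I + card I + card ({..<k} \<times> {..<p}) \<le> 4 * real p ^ 4"
      using k2 by (simp only: p4 card_cartesian_product card_lessThan of_nat_mult)
    then have "(real (card {..<k}) + card I + card I + card ({..<k} \<times> {..<p})) * \<eta> \<le> 4 * real p ^ 4 * \<eta>"
      by (intro mult_right_mono) (auto simp: \<eta>_def tail_const_ge)
    then show ?thesis by (simp add: algebra_simps)
  qed
  finally have "prob (space M - B) \<ge> 1 - (4 * real p ^ 4 * \<eta>
      + real ((2 * p ^ 5 + 1) ^ (p + k)) * exp (- ((real p powr (61/100))\<^sup>2 / 2)))"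
    using prob_compl[OF B] by simp
  moreover have "typical p k (\<lambda>i j. w i j x)" if x: "x \<in> space M" "x \<notin> B" for x
  proof -
    have "\<forall>i<k. x \<notin> B1 i" "\<forall>i<k. \<forall>j<k. i \<noteq> j \<longrightarrow> x \<notin> B2 (i, j)" "\<forall>i<k. \<forall>j<k. i \<noteq> j \<longrightarrow> x \<notin> B3 (i, j)"
      "\<forall>i<k. \<forall>j<p. x \<notin> B4 (i, j)" and 5: "x \<notin> B5"
      using x(2) unfolding B_def I_def by auto
    moreover have "(\<Sum>i<k. \<Sum>j<p. y i * u j * w i j x) \<le> real p powr (61/100)"
      if "u \<in> grid (p ^ 5) p" "y \<in> grid (p ^ 5) k" "(\<Sum>j<p. (u j)\<^sup>2) \<le> 1" "(\<Sum>i<k. (y i)\<^sup>2) \<le> 1" for u y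
      using 5 x(1) that unfolding B5_def by (auto simp: not_less)
    ultimately show ?thesis
      unfolding typical_def B1_def B2_def B3_def B4_def using x(1) by (simp add: not_less)
  qed
  moreover have "space M - B \<in> events" using B by auto
  ultimately show ?thesis unfolding \<eta>_def by (intro bexI[of _ "space M - B"]) auto
qed

end

section \<open>Summing the failure probabilities\<close>

text \<open>Each of three terms gets a third of p^{-C}. The choice of q turns p^4 p^{-q/50} into at
  most p^{-C-1}, and the spare 1/p absorbs 4K. The grid term is beaten since p^{61/50} outgrows
  p^{6/5} log p. The last term is at most p^{2-(C+3)}, again with a factor 1/p to spare.\<close>

lemma eventually_small_tails:
  fixes C K :: real and q :: nat and k :: "nat \<Rightarrow> nat"
  assumes k: "\<forall>p>0. real (k p) \<le> real p powr (6/5)" and q: "real q \<ge> 50 * (C + 5)" and K: "K \<ge> 0"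
  shows "eventually (\<lambda>p. (4 * real p ^ 4 * (K * real p powr (- (q / 50)))
      + real ((2 * p ^ 5 + 1) ^ (p + k p)) * exp (- ((real p powr (61/100))\<^sup>2 / 2)))
      + k p * real p powr (- (C + 3)) \<le> real p powr (- C)) sequentially"
proof -
  have ev1: "eventually (\<lambda>p::nat. (p + real p powr (6/5)) * ln (2 * real p ^ 5 + 1) - real p powr (61/50) / 2 \<le> - real p) sequentially"
    by real_asymp
  have ev2: "eventually (\<lambda>p::nat. exp (- real p) \<le> real p powr (- C) / 3) sequentially"
    by real_asymp
  have ev3: "eventually (\<lambda>p::nat. real p \<ge> max 3 (12 * K)) sequentially"
    by (intro eventually_compose_filterlim[OF eventually_ge_at_top filterlim_real_sequentially])
  show ?thesis
    using ev1 ev2 ev3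
  proof eventually_elim
    case (elim p)
    have p: "real p \<ge> 3" "real p \<ge> 12 * K" using elim(3) by auto
    have "4 * real p ^ 4 * (K * real p powr (- (q / 50))) \<le> 4 * real p ^ 4 * (K * real p powr (- (C + 5)))"
      using p q K by (intro mult_left_mono powr_mono) auto
    also have "\<dots> = 4 * K * (real p powr 4 * real p powr (- (C + 5)))"
      using p by (simp add: powr_numeral)
    also have "real p powr 4 * real p powr (- (C + 5)) = real p powr (- C) * real p powr (- 1)"
      unfolding powr_add[symmetric] by (simp add: algebra_simps)
    also have "4 * K * (real p powr (- C) * real p powr (- 1)) = (4 * K / p) * real p powr (- C)"
      using p by (simp add: powr_minus field_simps)
    also have "\<dots> \<le> (1 / 3) * real p powr (- C)"
      using p by (intro mult_right_mono) (auto simp: field_simps)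
    finally have 1: "4 * real p ^ 4 * (K * real p powr (- (q / 50))) \<le> real p powr (- C) / 3" by simp
    have "real ((2 * p ^ 5 + 1) ^ (p + k p)) = exp (ln (2 * real p ^ 5 + 1)) ^ (p + k p)"
    proof -
      have "2 * real p ^ 5 + 1 > 0" by (simp add: add_nonneg_pos)
      then show ?thesis by (simp add: add.commute)
    qed
    also have "\<dots> = exp ((p + k p) * ln (2 * real p ^ 5 + 1))"
      by (subst exp_of_nat_mult[symmetric]) simp
    also have "\<dots> \<le> exp ((p + real p powr (6/5)) * ln (2 * real p ^ 5 + 1))"
      using k p by (simp add: mult_right_mono)
    finally have "real ((2 * p ^ 5 + 1) ^ (p + k p)) * exp (- ((real p powr (61/100))\<^sup>2 / 2))
        \<le> exp ((p + real p powr (6/5)) * ln (2 * real p ^ 5 + 1)) * exp (- ((real p powr (61/100))\<^sup>2 / 2))"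
      by (intro mult_right_mono) auto
    also have "\<dots> = exp ((p + real p powr (6/5)) * ln (2 * real p ^ 5 + 1) - real p powr (61/50) / 2)"
      by (simp add: power2_eq_square flip: exp_add powr_add)
    also have "\<dots> \<le> exp (- real p)" using elim(1) by simp
    also have "\<dots> \<le> real p powr (- C) / 3" by (rule elim(2))
    finally have 2: "real ((2 * p ^ 5 + 1) ^ (p + k p)) * exp (- ((real p powr (61/100))\<^sup>2 / 2)) \<le> real p powr (- C) / 3" .
    have "k p * real p powr (- (C + 3)) \<le> real p powr 2 * real p powr (- (C + 3))"
    proof (rule mult_right_mono)
      have "real p powr (6/5) \<le> real p powr 2" using p by (intro powr_mono) auto
      moreover have "real (k p) \<le> real p powr (6/5)" using k p by simp
      ultimately show "real (k p) \<le> real p powr 2" by linarith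
    qed simp
    also have "\<dots> = real p powr (- C) * real p powr (- 1)"
      unfolding powr_add[symmetric] by (simp add: algebra_simps)
    also have "\<dots> \<le> real p powr (- C) * (1 / 3)"
      using p by (intro mult_left_mono) (auto simp: powr_minus field_simps)
    finally have 3: "k p * real p powr (- (C + 3)) \<le> real p powr (- C) / 3" by simp
    show ?case using 1 2 3 by simp
  qed
qed

theorem theorem3:
  fixes \<epsilon> :: real
    and k :: "nat \<Rightarrow> nat"
    and M :: "nat \<Rightarrow> 'a measure"
    and w :: "nat \<Rightarrow> nat \<Rightarrow> nat \<Rightarrow> 'a \<Rightarrow> real"
    and \<pi> :: "nat \<Rightarrow> nat \<Rightarrow> 'a \<Rightarrow> real"
  assumes eps: "\<epsilon> > 0"
    and k_bound: "\<And>p. real (k p) \<le> real p powr (6/5 - \<epsilon>)"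
    and prob: "\<And>p. prob_space (M p)"
    and w_indep: "\<And>p. prob_space.indep_vars (M p) (\<lambda>_. borel) (\<lambda>(i, j). w p i j)
                          ({..<k p} \<times> {..<p})"
    and w_gauss: "\<And>p i j. i < k p \<Longrightarrow> j < p \<Longrightarrow>
                    distributed (M p) lborel (w p i j) (\<lambda>x. ennreal (std_normal_density x))"
    and pi_rv: "\<And>p i. i < k p \<Longrightarrow> \<pi> p i \<in> borel_measurable (M p)"
    and pi_conc: "\<And>\<delta> C. \<delta> > 0 \<Longrightarrow> eventually (\<lambda>p. \<forall>i < k p.
                    measure (M p) {x \<in> space (M p). \<bar>1 / (\<pi> p i x)\<^sup>2 - 1\<bar> \<le> real p powr (-1/2 + \<delta>)}
                      \<ge> 1 - real p powr (- C)) sequentially"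
  shows "with_vhp M (\<lambda>p. {x \<in> space (M p). \<exists>Y. symmetric_psd p Y \<and>
            (\<forall>i < k p. quad_form p Y (\<lambda>j. \<pi> p i x * w p i j x) = 1)})"
proof -
  have k: "\<forall>p>0. real (k p) \<le> real p powr (6/5)"
    using order_trans[OF k_bound] powr_mono[of "6/5 - \<epsilon>" "6/5"] eps by simp
  show ?thesis
    unfolding with_vhp_def
  proof
    fix C :: real
    define q where "q = nat \<lceil>50 * (C + 5)\<rceil>"
    have q: "real q \<ge> 50 * (C + 5)" unfolding q_def by linarith
    \<comment> \<open>\<delta> = 1/100 gives the exponent -49/100 of the deterministic part. The
      shift from C to C + 3 leaves room for a union bound over k <= p^2 indices.\<close>
    have ev: "eventually (\<lambda>p. \<forall>i < k p.
        measure (M p) {x \<in> space (M p). \<bar>1 / (\<pi> p i x)\<^sup>2 - 1\<bar> \<le> real p powr (-1/2 + 1/100)}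
          \<ge> 1 - real p powr (- (C + 3))) sequentially"
      by (rule pi_conc) simp
    show "eventually (\<lambda>p. \<exists>A\<in>sets (M p). A \<subseteq> {x \<in> space (M p). \<exists>Y. symmetric_psd p Y \<and>
        (\<forall>i < k p. quad_form p Y (\<lambda>j. \<pi> p i x * w p i j x) = 1)} \<and>
        1 - real p powr (- C) \<le> measure (M p) A) sequentially"
      using ev eventually_large eventually_small_tails[OF k q tail_const_ge(5)[of q]]
    proof eventually_elim
      case (elim p)
      have p: "p > 0" using elim(2) by (simp add: large_def)
      then have kp: "real (k p) \<le> real p powr (6/5)" using k by simp
      interpret prob_space "M p" by (rule prob)
      interpret gaussian_matrix "M p" "w p" "k p" p
        by unfold_locales (use w_indep w_gauss p in auto)
      obtain A where A: "A \<in> events" "\<And>x. x \<in> A \<Longrightarrow> x \<in> space (M p) \<and> typical p (k p) (\<lambda>i j. w p i j x)"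
        "prob A \<ge> 1 - (4 * real p ^ 4 * (tail_const q * real p powr (- (q / 50)))
          + real ((2 * p ^ 5 + 1) ^ (p + k p)) * exp (- ((real p powr (61/100))\<^sup>2 / 2)))"
        using typical_vhp[OF kp, of q] by blast
      define G where "G i = {x \<in> space (M p). \<bar>1 / (\<pi> p i x)\<^sup>2 - 1\<bar> \<le> real p powr (-1/2 + 1/100)}" for i
      \<comment> \<open>The scalings enter only through this union bound, so their joint law with w
        does not matter.\<close>
      define B where "B = (\<Union>i\<in>{..<k p}. space (M p) - G i)"
      have G: "G i \<in> events" if "i < k p" for i
      proof -
        note [measurable] = pi_rv[OF that]
        show ?thesis unfolding G_def by measurable
      qed
      have B: "B \<in> events" unfolding B_def using G by (intro sets.finite_UN) auto
      have "prob B \<le> card {..<k p} * real p powr (- (C + 3))"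
        unfolding B_def
      proof (rule prob_UN_le)
        fix i assume i: "i \<in> {..<k p}"
        then have "prob (G i) \<ge> 1 - real p powr (- (C + 3))" using elim(1) by (simp add: G_def)
        then show "prob (space (M p) - G i) \<le> real p powr (- (C + 3))"
          using prob_compl[OF G] i by simp
      qed (use G in auto)
      moreover have "prob A \<le> prob (A - B) + prob B"
      proof -
        have "prob A \<le> prob ((A - B) \<union> B)" using A(1) B by (intro finite_measure_mono) auto
        also have "\<dots> \<le> prob (A - B) + prob B" using A(1) B by (intro measure_Un_le) auto
        finally show ?thesis .
      qed
      ultimately have "1 - real p powr (- C) \<le> prob (A - B)" using elim(3) A(3) by simp
      moreover have "\<exists>Y. symmetric_psd p Y \<and> (\<forall>i < k p. quad_form p Y (\<lambda>j. \<pi> p i x * w p i j x) = 1)"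
        if x: "x \<in> A - B" for x
      proof (rule ellipsoid_fit[OF elim(2) kp])
        show "typical p (k p) (\<lambda>i j. w p i j x)" using A(2) x by blast
        show "\<bar>1 / (\<pi> p i x)\<^sup>2 - 1\<bar> \<le> real p powr (-49/100)" if "i < k p" for i
          using x that A(2) by (auto simp: B_def G_def)
      qed
      ultimately show ?case using A B by (intro bexI[of _ "A - B"]) auto
    qed
  qed
qed

end
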